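(* Let $\{G_n\}$ be a sequence of finite random graphs such that $n_1=n_1(n)=|V(G_n)|\ge 3$ is non-random and $n_1\to\infty$, let $v_n^*$ be uniformly random in $V(G_n)$ given $G_n$, and let $G^*$ be a random element of $\mathcal{G}_*$ with root $r^*$. Let $d_n$ be the degree of $v_n^*$ in $G_n$ and let $d^*$ be the degree of $r^*$ in $G^*$. Suppose $\mathcal{L}((G_n,v_n^* )|G_n)\xrightarrow{p}\mathcal{L}(G^* )$, $\mathbb{E}\,d_n^3\to\mathbb{E}\,(d^* )^3<\infty$ and $\mathrm{Var}(d^* )>0$. Then $$r(G_n)\xrightarrow{p}\rho^*:=\frac{\mathbb{E} d^*\;\mathbb{E}\,\mathrm{hom}'(P_4',G^*,r^* )-(\mathbb{E}(d^* )^2)^2}{\mathbb{E} d^*\;\mathbb{E}(d^* )^3-(\mathbb{E}(d^* )^2)^2}.$$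
   Context: Graphs are simple and undirected; limits are as $n\to\infty$. $B_r(G,v)$ is the subgraph of $G$ induced on the vertices at distance at most $r$ from $v$, rooted at $v$ (and $B_r(G)=B_r(G,\mathrm{root}(G))$ for rooted $G$); $\cong$ is root-preserving isomorphism. $\mathcal{G}_*$ is the space of connected locally finite rooted graphs up to $\cong$ with metric $d_{loc}(G_1,G_2)=2^{-\sup\{r:\,B_r(G_1)\cong B_r(G_2)\}}$. Let $p_r(G,H)=|V(G)|^{-1}|\{v\in V(G):B_r(G,v)\cong H\}|$. $\mathcal{L}((G_n,v_n^* )|G_n)\xrightarrow{p}\mathcal{L}(G^* )$ means: for each integer $r\ge0$ and each connected rooted graph $H$, $p_r(G_n,H)\to\mathbb{P}(B_r(G^* )\cong H)$ in probability. For a rooted graph $H'$, $\mathrm{hom}'(H',G,v)$ is the number of graph homomorphisms from $H'$ to $G$ that map $\mathrm{root}(H')$ to $v$. $P_4'$ is the path on 4 vertices rooted at one of its internal vertices. The assortativity coefficient of a graph $G$ is $$r(G)=\frac{g(G)-b(G)^2}{b'(G)-b(G)^2},$$ where, with $d_G(v)$ the degree of $v$ in $G$, $e(G)=|E(G)|$ and sums over all $2e(G)$ ordered pairs $(u,v)$ of adjacent vertices of $G$, $g(G)=(2e(G))^{-1}\sum d_G(u)d_G(v)$, $b(G)=(2e(G))^{-1}\sum d_G(u)$, $b'(G)=(2e(G))^{-1}\sum d_G(u)^2$. Put $r(G)=0$ when $e(G)=0$ or $b'(G)-b(G)^2=0$.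
   Formalization: The formal theorem also assumes E d* E(d* )^3 ≠ (E(d* )^2)^2; Var(d* )>0 does not ensure this (if d* takes only the values 0 and 3, each with probability 1/2, then ρ* is 0/0), and only cases with ρ* undefined are excluded. *)

theory Defs
  imports "HOL-Probability.Probability"
begin

section \<open>Graphs, rooted graphs and balls\<close>

datatype 'a graph = Graph (verts: "'a set") (edges: "'a set set")

datatype 'a rgraph = Rooted (graph_of: "'a graph") (root: 'a)

definition simple_graph :: "'a graph \<Rightarrow> bool" where
  "simple_graph g \<longleftrightarrow> (\<forall>e\<in>edges g. e \<subseteq> verts g \<and> card e = 2)"

definition adj :: "'a graph \<Rightarrow> ('a \<times> 'a) set" where
  "adj g = {(u, v). {u, v} \<in> edges g}"

definition vertex_degree :: "'a graph \<Rightarrow> 'a \<Rightarrow> nat" where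
  "vertex_degree g v = card {u. (v, u) \<in> adj g}"

definition locally_finite :: "'a graph \<Rightarrow> bool" where
  "locally_finite g \<longleftrightarrow> (\<forall>v\<in>verts g. finite {u. (v, u) \<in> adj g})"

text \<open>The relation power \<open>adj g ^^ k\<close> relates the endpoints of the walks of length \<open>k\<close>; the
  infimum is \<open>\<infinity>\<close> if there is no walk.\<close>

definition gdist :: "'a graph \<Rightarrow> 'a \<Rightarrow> 'a \<Rightarrow> enat" where
  "gdist g u v = (INF k\<in>{k. (u, v) \<in> adj g ^^ k}. enat k)"

definition induced :: "'a graph \<Rightarrow> 'a set \<Rightarrow> 'a graph" where
  "induced g S = Graph (verts g \<inter> S) {e \<in> edges g. e \<subseteq> S}"

definition nbhd :: "nat \<Rightarrow> 'a graph \<Rightarrow> 'a \<Rightarrow> 'a rgraph" where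
  "nbhd r g v = Rooted (induced g {u \<in> verts g. gdist g v u \<le> enat r}) v"

definition is_rooted_iso :: "('a \<Rightarrow> 'b) \<Rightarrow> 'a rgraph \<Rightarrow> 'b rgraph \<Rightarrow> bool" where
  "is_rooted_iso f R S \<longleftrightarrow>
     bij_betw f (verts (graph_of R)) (verts (graph_of S)) \<and> f (root R) = root S \<and>
     (\<forall>u\<in>verts (graph_of R). \<forall>v\<in>verts (graph_of R).
        {u, v} \<in> edges (graph_of R) \<longleftrightarrow> {f u, f v} \<in> edges (graph_of S))"

definition rooted_iso :: "'a rgraph \<Rightarrow> 'b rgraph \<Rightarrow> bool" (infix \<open>\<cong>\<^sub>*\<close> 50) where
  "R \<cong>\<^sub>* S \<longleftrightarrow> (\<exists>f. is_rooted_iso f R S)"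

definition rooted_graph :: "'a rgraph \<Rightarrow> bool" where
  "rooted_graph R \<longleftrightarrow> simple_graph (graph_of R) \<and> root R \<in> verts (graph_of R)"

definition connected_rgraph :: "'a rgraph \<Rightarrow> bool" where
  "connected_rgraph R \<longleftrightarrow> rooted_graph R \<and>
     (\<forall>u\<in>verts (graph_of R). \<forall>v\<in>verts (graph_of R). gdist (graph_of R) u v < \<infinity>)"

text \<open>Number of homomorphisms \<open>H \<rightarrow> g\<close> that map the root of \<open>H\<close> to \<open>v\<close>.\<close>

definition hom' :: "'b rgraph \<Rightarrow> 'a graph \<Rightarrow> 'a \<Rightarrow> nat" where
  "hom' H g v = card {f \<in> verts (graph_of H) \<rightarrow>\<^sub>E verts g. f (root H) = v \<and>
     (\<forall>x y. {x, y} \<in> edges (graph_of H) \<longrightarrow> {f x, f y} \<in> edges g)}"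

definition P4' :: "nat rgraph" where
  "P4' = Rooted (Graph {0, 1, 2, 3} {{0, 1}, {1, 2}, {2, 3}}) 1"

text \<open>Sums over \<open>adj g\<close> are sums over all ordered pairs of adjacent vertices.\<close>

definition assort_g :: "'a graph \<Rightarrow> real" where
  "assort_g g = (\<Sum>(u, v)\<in>adj g. real (vertex_degree g u) * real (vertex_degree g v)) / (2 * real (card (edges g)))"

definition assort_b :: "'a graph \<Rightarrow> real" where
  "assort_b g = (\<Sum>(u, v)\<in>adj g. real (vertex_degree g u)) / (2 * real (card (edges g)))"

definition assort_b' :: "'a graph \<Rightarrow> real" where
  "assort_b' g = (\<Sum>(u, v)\<in>adj g. (real (vertex_degree g u))\<^sup>2) / (2 * real (card (edges g)))"

definition assortativity :: "'a graph \<Rightarrow> real" where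
  "assortativity g =
     (if card (edges g) = 0 \<or> assort_b' g - (assort_b g)\<^sup>2 = 0 then 0
      else (assort_g g - (assort_b g)\<^sup>2) / (assort_b' g - (assort_b g)\<^sup>2))"


subsection \<open>Isomorphisms and balls\<close>

lemma is_rooted_iso_id: "is_rooted_iso (\<lambda>x. x) R R"
  by (auto simp: is_rooted_iso_def bij_betw_def)

lemma is_rooted_iso_cong:
  assumes "is_rooted_iso f R S" "\<And>x. x \<in> verts (graph_of R) \<Longrightarrow> f x = g x" "root R \<in> verts (graph_of R)"
  shows "is_rooted_iso g R S"
  using assms bij_betw_cong[of "verts (graph_of R)" f g] unfolding is_rooted_iso_def by metis

lemma is_rooted_iso_comp:
  assumes "is_rooted_iso f R S" "is_rooted_iso g S T"
  shows "is_rooted_iso (\<lambda>x. g (f x)) R T"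
proof -
  have "f x \<in> verts (graph_of S)" if "x \<in> verts (graph_of R)" for x
    using assms that by (auto simp: is_rooted_iso_def bij_betw_def)
  then show ?thesis
    using assms bij_betw_trans[of f "verts (graph_of R)" "verts (graph_of S)" g "verts (graph_of T)"]
    unfolding is_rooted_iso_def comp_def by simp
qed

lemma is_rooted_iso_inv:
  assumes "is_rooted_iso f R S" "root R \<in> verts (graph_of R)"
  shows "is_rooted_iso (inv_into (verts (graph_of R)) f) S R"
proof -
  let ?g = "inv_into (verts (graph_of R)) f"
  have b: "bij_betw f (verts (graph_of R)) (verts (graph_of S))" "f (root R) = root S"
    using assms by (auto simp: is_rooted_iso_def)
  have fg: "f (?g y) = y" "?g y \<in> verts (graph_of R)" if "y \<in> verts (graph_of S)" for y
    using b(1) that by (auto simp: bij_betw_def f_inv_into_f inv_into_into)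
  have "?g (root S) = root R"
    using b assms(2) by (metis bij_betw_def inv_into_f_f)
  moreover have "bij_betw ?g (verts (graph_of S)) (verts (graph_of R))"
    using b(1) by (rule bij_betw_inv_into)
  ultimately show ?thesis
    using assms(1) fg unfolding is_rooted_iso_def by metis
qed

lemma rooted_iso_refl: "R \<cong>\<^sub>* R"
  unfolding rooted_iso_def using is_rooted_iso_id by blast

lemma rooted_iso_trans: "R \<cong>\<^sub>* S \<Longrightarrow> S \<cong>\<^sub>* T \<Longrightarrow> R \<cong>\<^sub>* T"
  unfolding rooted_iso_def using is_rooted_iso_comp by blast

lemma rooted_iso_sym: "R \<cong>\<^sub>* S \<Longrightarrow> root R \<in> verts (graph_of R) \<Longrightarrow> S \<cong>\<^sub>* R"
  unfolding rooted_iso_def using is_rooted_iso_inv by blast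

lemma gdist_le_iff: "gdist g u v \<le> enat r \<longleftrightarrow> (\<exists>k\<le>r. (u, v) \<in> adj g ^^ k)"
proof
  assume L: "gdist g u v \<le> enat r"
  let ?A = "enat ` {k. (u, v) \<in> adj g ^^ k}"
  have "?A \<noteq> {}"
  proof
    assume "?A = {}"
    then have "gdist g u v = \<infinity>" by (simp add: gdist_def top_enat_def)
    then show False using L by simp
  qed
  then have "Inf ?A \<in> ?A"
    using wellorder_InfI by (metis ex_in_conv)
  then show "\<exists>k\<le>r. (u, v) \<in> adj g ^^ k"
    using L by (auto simp: gdist_def)
next
  assume "\<exists>k\<le>r. (u, v) \<in> adj g ^^ k"
  then obtain k where "k \<le> r" "(u, v) \<in> adj g ^^ k" by blast
  then show "gdist g u v \<le> enat r"
    unfolding gdist_def by (intro INF_lower2[of k]) auto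
qed

lemma adj_verts: "simple_graph g \<Longrightarrow> (u, v) \<in> adj g \<Longrightarrow> u \<in> verts g \<and> v \<in> verts g"
  by (auto simp: simple_graph_def adj_def dest!: bspec)

lemma relpow_verts: "simple_graph g \<Longrightarrow> u \<in> verts g \<Longrightarrow> (u, v) \<in> adj g ^^ k \<Longrightarrow> v \<in> verts g"
  by (cases k) (auto dest: adj_verts)

lemma verts_nbhd: "verts (graph_of (nbhd r g v)) = {u \<in> verts g. \<exists>k\<le>r. (v, u) \<in> adj g ^^ k}"
  by (auto simp: nbhd_def induced_def gdist_le_iff)

lemma root_nbhd [simp]: "root (nbhd r g v) = v"
  by (simp add: nbhd_def)

lemma root_in_nbhd: "v \<in> verts g \<Longrightarrow> v \<in> verts (graph_of (nbhd r g v))"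
  by (auto simp: verts_nbhd intro!: exI[of _ 0])

lemma edges_nbhd:
  "u \<in> verts (graph_of (nbhd r g v)) \<Longrightarrow> w \<in> verts (graph_of (nbhd r g v)) \<Longrightarrow>
    {u, w} \<in> edges (graph_of (nbhd r g v)) \<longleftrightarrow> {u, w} \<in> edges g"
  by (auto simp: nbhd_def induced_def)

lemma simple_nbhd: "simple_graph g \<Longrightarrow> simple_graph (graph_of (nbhd r g v))"
  by (auto simp: simple_graph_def nbhd_def induced_def)

lemma verts_nbhd_mono: "r \<le> s \<Longrightarrow> verts (graph_of (nbhd r g v)) \<subseteq> verts (graph_of (nbhd s g v))"
  by (auto simp: verts_nbhd intro: order_trans)

lemma relpow_iso:
  assumes "simple_graph (graph_of R)" "is_rooted_iso f R S" "u \<in> verts (graph_of R)"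
    "(u, w) \<in> adj (graph_of R) ^^ k"
  shows "(f u, f w) \<in> adj (graph_of S) ^^ k"
  using assms(4)
proof (induction k arbitrary: w)
  case (Suc k)
  then obtain x where x: "(u, x) \<in> adj (graph_of R) ^^ k" "(x, w) \<in> adj (graph_of R)"
    by auto
  then have "(f x, f w) \<in> adj (graph_of S)"
    using adj_verts[OF assms(1) x(2)] assms(2) by (auto simp: adj_def is_rooted_iso_def)
  then show ?case using Suc.IH[OF x(1)] by auto
qed simp

lemma is_rooted_iso_nbhd:
  assumes "rooted_graph R" "rooted_graph S" "is_rooted_iso f R S"
  shows "is_rooted_iso f (nbhd r (graph_of R) (root R)) (nbhd r (graph_of S) (root S))"
proof -
  let ?R = "graph_of R" and ?S = "graph_of S"
  let ?VR = "verts (graph_of (nbhd r ?R (root R)))" and ?VS = "verts (graph_of (nbhd r ?S (root S)))"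
  let ?g = "inv_into (verts ?R) f"
  have R: "simple_graph ?R" "root R \<in> verts ?R" and S: "simple_graph ?S" "root S \<in> verts ?S"
    using assms by (auto simp: rooted_graph_def)
  have g: "is_rooted_iso ?g S R"
    using is_rooted_iso_inv[OF assms(3) R(2)] .
  have b: "bij_betw f (verts ?R) (verts ?S)" "f (root R) = root S" "?g (root S) = root R"
    using assms(3) g by (auto simp: is_rooted_iso_def)
  have "f ` ?VR = ?VS"
  proof (intro equalityI subsetI)
    fix y assume "y \<in> f ` ?VR"
    then show "y \<in> ?VS"
      using relpow_iso[OF R(1) assms(3) R(2)] b by (fastforce simp: verts_nbhd bij_betw_def)
  next
    fix y assume y: "y \<in> ?VS"
    then obtain k where k: "y \<in> verts ?S" "k \<le> r" "(root S, y) \<in> adj ?S ^^ k"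
      by (auto simp: verts_nbhd)
    have "(root R, ?g y) \<in> adj ?R ^^ k"
      using relpow_iso[OF S(1) g S(2) k(3)] b by simp
    moreover have "?g y \<in> verts ?R" "f (?g y) = y"
      using b(1) k(1) by (auto simp: bij_betw_def f_inv_into_f inv_into_into)
    ultimately show "y \<in> f ` ?VR"
      using k(2) by (auto simp: verts_nbhd intro!: image_eqI[of _ _ "?g y"])
  qed
  moreover have "?VR \<subseteq> verts ?R"
    by (auto simp: verts_nbhd)
  ultimately have bb: "bij_betw f ?VR ?VS"
    using b(1) inj_on_subset[of f "verts ?R" ?VR] unfolding bij_betw_def by blast
  moreover have "{u, w} \<in> edges (graph_of (nbhd r ?R (root R))) \<longleftrightarrow>
      {f u, f w} \<in> edges (graph_of (nbhd r ?S (root S)))" if "u \<in> ?VR" "w \<in> ?VR" for u w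
  proof -
    have "f u \<in> ?VS" "f w \<in> ?VS" using that bb by (auto simp: bij_betw_def)
    then show ?thesis
      using that \<open>?VR \<subseteq> verts ?R\<close> assms(3) by (auto simp: edges_nbhd is_rooted_iso_def)
  qed
  ultimately show ?thesis
    using b unfolding is_rooted_iso_def by simp
qed

lemma relpow_nbhd:
  assumes "simple_graph g" "v \<in> verts g" "k \<le> s"
  shows "(v, u) \<in> adj (graph_of (nbhd s g v)) ^^ k \<longleftrightarrow> (v, u) \<in> adj g ^^ k"
  using assms(3)
proof (induction k arbitrary: u)
  case (Suc k)
  let ?V = "verts (graph_of (nbhd s g v))"
  have "(x, u) \<in> adj (graph_of (nbhd s g v)) \<longleftrightarrow> (x, u) \<in> adj g"
    if x: "(v, x) \<in> adj g ^^ k" for x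
  proof
    assume "(x, u) \<in> adj (graph_of (nbhd s g v))"
    then show "(x, u) \<in> adj g" by (auto simp: adj_def nbhd_def induced_def)
  next
    assume xu: "(x, u) \<in> adj g"
    then have "(v, u) \<in> adj g ^^ Suc k" using x by auto
    then have "u \<in> ?V"
      using Suc.prems adj_verts[OF assms(1) xu] unfolding verts_nbhd by blast
    moreover have "x \<in> ?V"
      using x Suc_leD[OF Suc.prems] adj_verts[OF assms(1) xu] unfolding verts_nbhd by blast
    ultimately show "(x, u) \<in> adj (graph_of (nbhd s g v))"
      using xu by (auto simp: adj_def edges_nbhd)
  qed
  then show ?case using Suc.IH Suc.prems by (auto simp: relcomp_unfold)
qed simp

lemma induced_induced: "A \<subseteq> B \<Longrightarrow> induced (induced g B) A = induced g A"
  by (auto simp: induced_def)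

lemma nbhd_alt: "nbhd r g v = Rooted (induced g (verts (graph_of (nbhd r g v)))) v"
proof -
  have "verts (graph_of (nbhd r g v)) = {u \<in> verts g. gdist g v u \<le> enat r}"
    by (auto simp: nbhd_def induced_def)
  then show ?thesis by (simp add: nbhd_def)
qed

lemma nbhd_nbhd:
  assumes "simple_graph g" "v \<in> verts g" "r \<le> s"
  shows "nbhd r (graph_of (nbhd s g v)) v = nbhd r g v"
proof -
  let ?h = "graph_of (nbhd s g v)"
  have eq: "(\<exists>k\<le>r. (v, u) \<in> adj ?h ^^ k) \<longleftrightarrow> (\<exists>k\<le>r. (v, u) \<in> adj g ^^ k)" for u
    using relpow_nbhd[OF assms(1,2)] assms(3) order_trans by metis
  have sub: "verts (graph_of (nbhd r g v)) \<subseteq> verts ?h"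
    using verts_nbhd_mono[OF assms(3)] .
  have hg: "verts ?h \<subseteq> verts g" unfolding verts_nbhd by blast
  have V: "verts (graph_of (nbhd r ?h v)) = verts (graph_of (nbhd r g v))"
    using sub hg unfolding verts_nbhd[of r] eq by blast
  have h: "?h = induced g (verts ?h)"
    by (subst nbhd_alt) simp
  have "nbhd r ?h v = Rooted (induced ?h (verts (graph_of (nbhd r g v)))) v"
    using nbhd_alt[of r ?h v] unfolding V .
  also have "induced ?h (verts (graph_of (nbhd r g v))) = induced g (verts (graph_of (nbhd r g v)))"
    using induced_induced[OF sub, of g] h by simp
  also have "Rooted \<dots> v = nbhd r g v"
    by (rule nbhd_alt[symmetric])
  finally show ?thesis .
qed

lemma rooted_graph_nbhd:
  "simple_graph g \<Longrightarrow> v \<in> verts g \<Longrightarrow> rooted_graph (nbhd r g v)"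
  by (simp add: rooted_graph_def simple_nbhd root_in_nbhd)

lemma is_rooted_iso_nbhd_mono:
  assumes "rooted_graph R" "rooted_graph S" "r \<le> s"
    "is_rooted_iso f (nbhd s (graph_of R) (root R)) (nbhd s (graph_of S) (root S))"
  shows "is_rooted_iso f (nbhd r (graph_of R) (root R)) (nbhd r (graph_of S) (root S))"
  using is_rooted_iso_nbhd[OF _ _ assms(4), of r] assms(1-3)
  by (simp add: rooted_graph_def rooted_graph_nbhd nbhd_nbhd simple_nbhd root_in_nbhd)

lemma finite_nbhd:
  assumes "simple_graph g" "v \<in> verts g" "locally_finite g"
  shows "finite (verts (graph_of (nbhd r g v)))"
proof -
  have "finite {u. (v, u) \<in> adj g ^^ k}" for k
  proof (induction k)
    case (Suc k)
    have sub: "{u. (v, u) \<in> adj g ^^ Suc k} \<subseteq> (\<Union>x\<in>{u. (v, u) \<in> adj g ^^ k}. {u. (x, u) \<in> adj g})"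
      by auto
    have *: "finite {u. (x, u) \<in> adj g}" if "(v, x) \<in> adj g ^^ k" for x
      using relpow_verts[OF assms(1,2) that] assms(3) by (simp add: locally_finite_def)
    have "finite (\<Union>x\<in>{u. (v, u) \<in> adj g ^^ k}. {u. (x, u) \<in> adj g})"
      using Suc * by (intro finite_UN_I) auto
    with sub show ?case by (rule finite_subset)
  qed simp
  then have "finite (\<Union>k\<le>r. {u. (v, u) \<in> adj g ^^ k})" by blast
  then show ?thesis by (rule rev_finite_subset) (auto simp: verts_nbhd)
qed

lemma rooted_iso_if_nbhd_iso:
  assumes R: "connected_rgraph R" "locally_finite (graph_of R)"
    and S: "connected_rgraph S" "locally_finite (graph_of S)"
    and iso: "\<And>r. nbhd r (graph_of R) (root R) \<cong>\<^sub>* nbhd r (graph_of S) (root S)"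
  shows "R \<cong>\<^sub>* S"
proof -
  define B where "B r = nbhd r (graph_of R) (root R)" for r
  define C where "C r = nbhd r (graph_of S) (root S)" for r
  define V where "V r = verts (graph_of (B r))" for r
  define W where "W r = verts (graph_of (C r))" for r
  have rR: "rooted_graph R" "simple_graph (graph_of R)" "root R \<in> verts (graph_of R)"
    and rS: "rooted_graph S" "simple_graph (graph_of S)" "root S \<in> verts (graph_of S)"
    using R S by (auto simp: connected_rgraph_def rooted_graph_def)
  define P where "P r f \<longleftrightarrow> f \<in> extensional (V r) \<and> is_rooted_iso f (B r) (C r)" for r f
  have rootV: "root R \<in> V r" for r
    using rR by (simp add: V_def B_def root_in_nbhd)
  have Vmono: "V r \<subseteq> V s" if "r \<le> s" for r s
    using verts_nbhd_mono[OF that] by (simp add: V_def B_def)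
  have finP: "finite {f. P r f}" for r
  proof (rule finite_subset)
    show "{f. P r f} \<subseteq> V r \<rightarrow>\<^sub>E W r"
      by (auto simp: P_def PiE_def is_rooted_iso_def bij_betw_def V_def W_def)
    show "finite (V r \<rightarrow>\<^sub>E W r)"
      unfolding V_def W_def B_def C_def using R(2) S(2) rR rS by (intro finite_PiE finite_nbhd)
  qed
  have restr: "is_rooted_iso (restrict f (V r)) (B r) (C r)" if "is_rooted_iso f (B r) (C r)" for f r
    by (rule is_rooted_iso_cong[OF that]) (use rootV[of r] in \<open>auto simp: V_def B_def\<close>)
  have Pr: "P r (restrict f (V r))" if "P s f" "r \<le> s" for r s f
    using restr is_rooted_iso_nbhd_mono[OF rR(1) rS(1) that(2)] that(1)
    by (auto simp: P_def B_def C_def)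
  have exP: "\<exists>f. P r f" for r
    using iso[of r] restr[of _ r] unfolding rooted_iso_def P_def B_def[symmetric] C_def[symmetric]
    by (meson restrict_extensional)
  define good where "good r f \<longleftrightarrow> P r f \<and> (\<forall>s\<ge>r. \<exists>g. P s g \<and> restrict g (V r) = f)" for r f
  have pig: "\<exists>f. good r f \<and> Q f"
    if Q: "\<And>s. s \<ge> r \<Longrightarrow> \<exists>g. P s g \<and> Q (restrict g (V r))" for r Q
  proof -
    obtain G where G: "\<And>s. s \<ge> r \<Longrightarrow> P s (G s) \<and> Q (restrict (G s) (V r))"
      using Q by metis
    have "(\<lambda>s. restrict (G s) (V r)) ` {r..} \<subseteq> {f. P r f}"
      using G Pr by auto
    then have "finite ((\<lambda>s. restrict (G s) (V r)) ` {r..})"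
      using finP finite_subset by blast
    from pigeonhole_infinite[OF infinite_Ici this] obtain t where t: "t \<in> {r..}"
      "infinite {s \<in> {r..}. restrict (G s) (V r) = restrict (G t) (V r)}"
      by blast
    have "\<exists>g. P s g \<and> restrict g (V r) = restrict (G t) (V r)" if "s \<ge> r" for s
    proof -
      obtain u where u: "u \<ge> s" "u \<ge> r" "restrict (G u) (V r) = restrict (G t) (V r)"
        using t(2) unfolding infinite_nat_iff_unbounded_le by auto
      have "P s (restrict (G u) (V s))" using G Pr u by auto
      moreover have "restrict (restrict (G u) (V s)) (V r) = restrict (G t) (V r)"
        using u(3) Vmono[OF that] by (simp add: Int_absorb1)
      ultimately show ?thesis by blast
    qed
    moreover have "P r (restrict (G t) (V r))" "Q (restrict (G t) (V r))"
      using G Pr t(1) by auto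
    ultimately show ?thesis unfolding good_def by blast
  qed
  have "\<exists>f. good 0 f" using pig[of 0 "\<lambda>_. True"] exP by blast
  moreover have "\<exists>f'. good (Suc r) f' \<and> restrict f' (V r) = f" if gd: "good r f" for r f
  proof (rule pig)
    fix s assume s: "s \<ge> Suc r"
    then obtain g where "P s g" "restrict g (V r) = f"
      using gd Suc_leD[OF s] unfolding good_def by blast
    then show "\<exists>g. P s g \<and> restrict (restrict g (V (Suc r))) (V r) = f"
      using Vmono[of r "Suc r"] by (auto simp: Int_absorb1)
  qed
  ultimately obtain F where F: "\<And>r. good r (F r)" "\<And>r. restrict (F (Suc r)) (V r) = F r"
    using dependent_nat_choice[of good "\<lambda>r f f'. restrict f' (V r) = f"] by metis
  have FP: "is_rooted_iso (F r) (B r) (C r)" for r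
    using F(1) by (simp add: good_def P_def)
  have Feq: "F s x = F r x" if "r \<le> s" "x \<in> V r" for r s x
    using that
  proof (induction s rule: dec_induct)
    case (step s)
    have "x \<in> V s" using step Vmono by blast
    then have "F (Suc s) x = F s x" using F(2)[of s] by (metis restrict_apply')
    then show ?case using step by simp
  qed simp
  have cover: "\<exists>r. x \<in> verts (graph_of (nbhd r (graph_of T) (root T)))"
    if "connected_rgraph T" "x \<in> verts (graph_of T)" for x and T :: "'c rgraph"
  proof -
    have "gdist (graph_of T) (root T) x < \<infinity>"
      using that by (auto simp: connected_rgraph_def rooted_graph_def)
    then obtain r where "gdist (graph_of T) (root T) x \<le> enat r"
      by (metis enat_ord_simps(4) not_infinity_eq order_refl)
    then show ?thesis using that(2) by (auto simp: verts_nbhd gdist_le_iff)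
  qed
  define f where "f x = F (LEAST r. x \<in> V r) x" for x
  have f: "f x = F r x" if "x \<in> V r" for x r
    unfolding f_def using Feq[OF Least_le] LeastI[of "\<lambda>r. x \<in> V r"] that by metis
  have fiso: "is_rooted_iso f (B r) (C r)" for r
    by (rule is_rooted_iso_cong[OF FP]) (use f rootV[of r] in \<open>auto simp: V_def B_def\<close>)
  have VU: "\<exists>r. x \<in> V r" if "x \<in> verts (graph_of R)" for x
    using cover[OF R(1) that] by (simp add: V_def B_def)
  have two: "\<exists>r. x \<in> V r \<and> y \<in> V r" if xy: "x \<in> verts (graph_of R)" "y \<in> verts (graph_of R)" for x y
  proof -
    obtain r s where "x \<in> V r" "y \<in> V s" using VU xy by blast
    then show ?thesis using Vmono[of r "max r s"] Vmono[of s "max r s"] by auto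
  qed
  have fW: "bij_betw f (V r) (W r)" for r
    using fiso by (simp add: is_rooted_iso_def V_def W_def)
  have WS: "W r \<subseteq> verts (graph_of S)" "V r \<subseteq> verts (graph_of R)" for r
    by (auto simp: W_def V_def B_def C_def verts_nbhd)
  have "inj_on f (verts (graph_of R))"
    by (rule inj_onI) (use two fW in \<open>meson bij_betw_def inj_onD\<close>)
  moreover have "f ` verts (graph_of R) = verts (graph_of S)"
  proof (intro equalityI subsetI)
    fix y assume "y \<in> f ` verts (graph_of R)"
    then show "y \<in> verts (graph_of S)" using VU fW WS by (force simp: bij_betw_def)
  next
    fix y assume "y \<in> verts (graph_of S)"
    then obtain r where "y \<in> W r" using cover[OF S(1)] by (auto simp: W_def C_def)
    then show "y \<in> f ` verts (graph_of R)" using fW[of r] WS(2)[of r] by (force simp: bij_betw_def)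
  qed
  moreover have "{x, y} \<in> edges (graph_of R) \<longleftrightarrow> {f x, f y} \<in> edges (graph_of S)"
    if xy: "x \<in> verts (graph_of R)" "y \<in> verts (graph_of R)" for x y
  proof -
    obtain r where r: "x \<in> V r" "y \<in> V r" using two[OF xy] by blast
    then have "f x \<in> W r" "f y \<in> W r" using fW[of r] by (auto simp: bij_betw_def)
    then show ?thesis
      using r fiso[of r] by (simp add: is_rooted_iso_def V_def W_def B_def C_def edges_nbhd)
  qed
  moreover have "f (root R) = root S"
    using fiso[of 0] by (simp add: is_rooted_iso_def B_def C_def)
  ultimately show ?thesis
    unfolding rooted_iso_def is_rooted_iso_def bij_betw_def by blast
qed


section \<open>The metric space of connected locally finite rooted graphs\<close>

text \<open>A connected locally finite graph is countable, so vertices in \<^typ>\<open>nat\<close> represent every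
  isomorphism class.\<close>

definition gstar_rel :: "nat rgraph \<Rightarrow> nat rgraph \<Rightarrow> bool" where
  "gstar_rel R S \<longleftrightarrow> connected_rgraph R \<and> locally_finite (graph_of R) \<and>
     connected_rgraph S \<and> locally_finite (graph_of S) \<and> R \<cong>\<^sub>* S"

lemma root_verts: "connected_rgraph R \<Longrightarrow> root R \<in> verts (graph_of R)"
  by (simp add: connected_rgraph_def rooted_graph_def)

quotient_type gstar = "nat rgraph" / partial: gstar_rel
proof (rule part_equivpI)
  let ?R = "Rooted (Graph {0} {}) (0::nat)"
  have "gdist (Graph {0::nat} {}) 0 0 \<le> enat 0" unfolding gdist_le_iff by auto
  then have "gdist (Graph {0::nat} {}) 0 0 < \<infinity>" by (rule le_less_trans) simp
  then have "connected_rgraph ?R" "locally_finite (graph_of ?R)"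
    by (auto simp: connected_rgraph_def rooted_graph_def simple_graph_def locally_finite_def adj_def)
  then show "\<exists>R. gstar_rel R R" unfolding gstar_rel_def using rooted_iso_refl by blast
  show "symp gstar_rel"
    by (auto simp: symp_def gstar_rel_def intro: rooted_iso_sym root_verts)
  show "transp gstar_rel"
    by (auto simp: transp_def gstar_rel_def intro: rooted_iso_trans)
qed

lemma nbhd_iso_cong:
  assumes "gstar_rel R S"
  shows "nbhd r (graph_of R) (root R) \<cong>\<^sub>* nbhd r (graph_of S) (root S)"
  using assms is_rooted_iso_nbhd unfolding gstar_rel_def connected_rgraph_def rooted_iso_def by blast

lemma nbhd_iso_sym:
  assumes "connected_rgraph R" "nbhd r (graph_of R) (root R) \<cong>\<^sub>* S"
  shows "S \<cong>\<^sub>* nbhd r (graph_of R) (root R)"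
  using assms by (auto intro!: rooted_iso_sym simp: root_in_nbhd root_verts)

lemma gstar_rel_sym: "gstar_rel R S \<Longrightarrow> gstar_rel S R"
  by (auto simp: gstar_rel_def intro: rooted_iso_sym root_verts)

lift_definition root_degree :: "gstar \<Rightarrow> nat" is "\<lambda>R. vertex_degree (graph_of R) (root R)"
proof -
  fix R S :: "nat rgraph" assume rel: "gstar_rel R S"
  then obtain f where f: "is_rooted_iso f R S" by (auto simp: gstar_rel_def rooted_iso_def)
  have R: "simple_graph (graph_of R)" "root R \<in> verts (graph_of R)"
    and S: "simple_graph (graph_of S)" "root S \<in> verts (graph_of S)"
    using rel by (auto simp: gstar_rel_def connected_rgraph_def rooted_graph_def)
  have b: "bij_betw f (verts (graph_of R)) (verts (graph_of S))" "f (root R) = root S"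
    using f by (auto simp: is_rooted_iso_def)
  have e: "(root R, u) \<in> adj (graph_of R) \<longleftrightarrow> (root S, f u) \<in> adj (graph_of S)"
    if "u \<in> verts (graph_of R)" for u
    using f that R by (auto simp: is_rooted_iso_def adj_def)
  have "f ` {u. (root R, u) \<in> adj (graph_of R)} = {u. (root S, u) \<in> adj (graph_of S)}"
  proof (intro equalityI subsetI)
    fix y assume "y \<in> f ` {u. (root R, u) \<in> adj (graph_of R)}"
    then show "y \<in> {u. (root S, u) \<in> adj (graph_of S)}" using e adj_verts[OF R(1)] by auto
  next
    fix y assume y: "y \<in> {u. (root S, u) \<in> adj (graph_of S)}"
    then have "y \<in> verts (graph_of S)" using adj_verts[OF S(1)] by blast
    then obtain x where "x \<in> verts (graph_of R)" "y = f x" using b by (auto simp: bij_betw_def)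
    then show "y \<in> f ` {u. (root R, u) \<in> adj (graph_of R)}" using e y by auto
  qed
  moreover have "{u. (root R, u) \<in> adj (graph_of R)} \<subseteq> verts (graph_of R)"
    using adj_verts[OF R(1)] by blast
  ultimately show "vertex_degree (graph_of R) (root R) = vertex_degree (graph_of S) (root S)"
    unfolding vertex_degree_def using b(1) by (metis bij_betw_def card_image inj_on_subset)
qed

lemma hom'_iso_le:
  assumes H: "root H \<in> verts (graph_of H)" "simple_graph (graph_of H)"
    and f: "is_rooted_iso f R S"
  shows "inj_on (\<lambda>h. restrict (\<lambda>x. f (h x)) (verts (graph_of H)))
      {h \<in> verts (graph_of H) \<rightarrow>\<^sub>E verts (graph_of R). h (root H) = root R \<and>
        (\<forall>x y. {x, y} \<in> edges (graph_of H) \<longrightarrow> {h x, h y} \<in> edges (graph_of R))}" (is "inj_on ?c ?A")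
    and "(\<lambda>h. restrict (\<lambda>x. f (h x)) (verts (graph_of H))) `
      {h \<in> verts (graph_of H) \<rightarrow>\<^sub>E verts (graph_of R). h (root H) = root R \<and>
        (\<forall>x y. {x, y} \<in> edges (graph_of H) \<longrightarrow> {h x, h y} \<in> edges (graph_of R))} \<subseteq>
      {h \<in> verts (graph_of H) \<rightarrow>\<^sub>E verts (graph_of S). h (root H) = root S \<and>
        (\<forall>x y. {x, y} \<in> edges (graph_of H) \<longrightarrow> {h x, h y} \<in> edges (graph_of S))}"
proof -
  have b: "inj_on f (verts (graph_of R))" "f ` verts (graph_of R) = verts (graph_of S)"
    "f (root R) = root S"
    using f by (auto simp: is_rooted_iso_def bij_betw_def)
  have HE: "x \<in> verts (graph_of H) \<and> y \<in> verts (graph_of H)" if "{x, y} \<in> edges (graph_of H)" for x y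
    using H(2) that by (auto simp: simple_graph_def)
  show "inj_on ?c ?A"
  proof (rule inj_onI)
    fix h k assume hk: "h \<in> ?A" "k \<in> ?A" "?c h = ?c k"
    show "h = k"
    proof (rule PiE_ext)
      show "h \<in> verts (graph_of H) \<rightarrow>\<^sub>E verts (graph_of R)" "k \<in> verts (graph_of H) \<rightarrow>\<^sub>E verts (graph_of R)"
        using hk by auto
      fix x assume x: "x \<in> verts (graph_of H)"
      have "f (h x) = f (k x)" using hk(3) x by (metis restrict_apply')
      moreover have "h x \<in> verts (graph_of R)" "k x \<in> verts (graph_of R)" using hk x by auto
      ultimately show "h x = k x" using b(1) by (meson inj_onD)
    qed
  qed
  show "?c ` ?A \<subseteq>
      {h \<in> verts (graph_of H) \<rightarrow>\<^sub>E verts (graph_of S). h (root H) = root S \<and>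
        (\<forall>x y. {x, y} \<in> edges (graph_of H) \<longrightarrow> {h x, h y} \<in> edges (graph_of S))}"
  proof (rule image_subsetI)
    fix h assume h: "h \<in> ?A"
    have hv: "h x \<in> verts (graph_of R)" if "x \<in> verts (graph_of H)" for x using h that by auto
    have "?c h \<in> verts (graph_of H) \<rightarrow>\<^sub>E verts (graph_of S)"
      using hv b(2) by auto
    moreover have "?c h (root H) = root S" using H(1) h b(3) by simp
    moreover have "{?c h x, ?c h y} \<in> edges (graph_of S)" if "{x, y} \<in> edges (graph_of H)" for x y
    proof -
      have "x \<in> verts (graph_of H)" "y \<in> verts (graph_of H)" using HE[OF that] by auto
      moreover have "{h x, h y} \<in> edges (graph_of R)" using h that by blast
      ultimately show ?thesis using f hv by (simp add: is_rooted_iso_def)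
    qed
    ultimately show "?c h \<in> {h \<in> verts (graph_of H) \<rightarrow>\<^sub>E verts (graph_of S). h (root H) = root S \<and>
        (\<forall>x y. {x, y} \<in> edges (graph_of H) \<longrightarrow> {h x, h y} \<in> edges (graph_of S))}" by blast
  qed
qed

lemma hom'_cong:
  assumes H: "rooted_graph H" and iso: "R \<cong>\<^sub>* S" and root: "root R \<in> verts (graph_of R)"
  shows "hom' H (graph_of R) (root R) = hom' H (graph_of S) (root S)"
proof -
  obtain f where f: "is_rooted_iso f R S" using iso by (auto simp: rooted_iso_def)
  have H': "root H \<in> verts (graph_of H)" "simple_graph (graph_of H)"
    using H by (auto simp: rooted_graph_def)
  note le = hom'_iso_le[OF H' f] hom'_iso_le[OF H' is_rooted_iso_inv[OF f root]]
  show ?thesis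
    unfolding hom'_def
    using Schroeder_Bernstein[OF le] by (auto dest: bij_betw_same_card)
qed

lemma rooted_graph_P4': "rooted_graph P4'"
  by (auto simp: rooted_graph_def simple_graph_def P4'_def)

lift_definition root_hom_P4' :: "gstar \<Rightarrow> nat" is "\<lambda>R. hom' P4' (graph_of R) (root R)"
  by (rule hom'_cong[OF rooted_graph_P4']) (auto simp: gstar_rel_def root_verts)

lift_definition ball_iso :: "nat \<Rightarrow> gstar \<Rightarrow> 'b rgraph \<Rightarrow> bool"
  is "\<lambda>r R H. nbhd r (graph_of R) (root R) \<cong>\<^sub>* H"
  by (intro ext iffI) (meson nbhd_iso_cong gstar_rel_sym rooted_iso_trans)+

lift_definition balls_agree :: "nat \<Rightarrow> gstar \<Rightarrow> gstar \<Rightarrow> bool"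
  is "\<lambda>r R S. nbhd r (graph_of R) (root R) \<cong>\<^sub>* nbhd r (graph_of S) (root S)"
  by (meson nbhd_iso_cong gstar_rel_sym rooted_iso_trans)

lemma balls_agree_sym: "balls_agree r x y \<Longrightarrow> balls_agree r y x"
  by transfer (auto simp: gstar_rel_def intro: nbhd_iso_sym)

lemma balls_agree_trans: "balls_agree r x y \<Longrightarrow> balls_agree r y z \<Longrightarrow> balls_agree r x z"
  by transfer (rule rooted_iso_trans)

lemma balls_agree_mono: "balls_agree s x y \<Longrightarrow> r \<le> s \<Longrightarrow> balls_agree r x y"
  by transfer
    (auto simp: gstar_rel_def connected_rgraph_def rooted_iso_def intro: is_rooted_iso_nbhd_mono)

lemma balls_agree_eq_iff: "(\<forall>r. balls_agree r x y) \<longleftrightarrow> x = y"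
  by transfer (auto simp: gstar_rel_def intro: rooted_iso_if_nbhd_iso nbhd_iso_cong)

lemma nbhd_0_iso:
  fixes R S :: "nat rgraph"
  assumes "gstar_rel R R" "gstar_rel S S"
  shows "nbhd 0 (graph_of R) (root R) \<cong>\<^sub>* nbhd 0 (graph_of S) (root S)"
proof -
  from assms have R: "simple_graph (graph_of R)" "root R \<in> verts (graph_of R)"
    and S: "simple_graph (graph_of S)" "root S \<in> verts (graph_of S)"
    by (auto simp: gstar_rel_def connected_rgraph_def rooted_graph_def)
  have v: "verts (graph_of (nbhd 0 g v)) = {v}" if "v \<in> verts g" for g and v :: nat
    using that by (auto simp: verts_nbhd)
  have e: "{v} \<notin> edges (graph_of (nbhd 0 g v))" if "simple_graph g" for g and v :: nat
    using simple_nbhd[OF that, of 0 v] unfolding simple_graph_def by (metis card_1_singleton_iff One_nat_def numeral_eq_one_iff semiring_norm(85))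
  have "is_rooted_iso (\<lambda>_. root S) (nbhd 0 (graph_of R) (root R)) (nbhd 0 (graph_of S) (root S))"
    using v R S e by (auto simp: is_rooted_iso_def bij_betw_def)
  then show "nbhd 0 (graph_of R) (root R) \<cong>\<^sub>* nbhd 0 (graph_of S) (root S)"
    by (auto simp: rooted_iso_def)
qed

lemma balls_agree_0: "balls_agree 0 x y"
proof -
  have "r = 0 \<longrightarrow> balls_agree r x y" for r
    by transfer (auto intro: nbhd_0_iso)
  then show ?thesis by simp
qed

text \<open>\<^const>\<open>Sup\<close> on \<^typ>\<open>nat\<close> is meaningful for bounded sets only, so the case in which the supremum is
  infinite is separated.\<close>

definition dloc :: "gstar \<Rightarrow> gstar \<Rightarrow> real" where
  "dloc x y = (if \<forall>r. balls_agree r x y then 0 else 1 / 2 ^ Sup {r. balls_agree r x y})"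

lemma dloc_le_iff: "dloc x y \<le> 1 / 2 ^ r \<longleftrightarrow> balls_agree r x y"
proof (cases "\<forall>r. balls_agree r x y")
  case False
  then obtain m where m: "\<not> balls_agree m x y" by blast
  let ?A = "{r. balls_agree r x y}"
  have sub: "?A \<subseteq> {..m}" using m balls_agree_mono nat_le_linear by blast
  then have fin: "finite ?A" using finite_subset by blast
  have "Sup ?A = Max ?A" using balls_agree_0 fin by (auto simp: Sup_nat_def)
  then have S: "Sup ?A \<in> ?A" "\<And>r. r \<in> ?A \<Longrightarrow> r \<le> Sup ?A"
    using Max_in[OF fin] fin balls_agree_0 by auto
  have "dloc x y \<le> 1 / 2 ^ r \<longleftrightarrow> r \<le> Sup ?A"
    unfolding dloc_def if_not_P[OF False] by (simp add: field_simps)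
  also have "\<dots> \<longleftrightarrow> balls_agree r x y" using S balls_agree_mono by blast
  finally show ?thesis .
qed (simp add: dloc_def)

instantiation gstar :: metric_space
begin

definition dist_gstar :: "gstar \<Rightarrow> gstar \<Rightarrow> real" where
  "dist_gstar = dloc"

definition uniformity_gstar :: "(gstar \<times> gstar) filter" where
  "uniformity_gstar = (INF e\<in>{0<..}. principal {(x, y). dist x y < e})"

definition open_gstar :: "gstar set \<Rightarrow> bool" where
  "open_gstar U \<longleftrightarrow> (\<forall>x\<in>U. eventually (\<lambda>(x', y). x' = x \<longrightarrow> y \<in> U) uniformity)"

instance
proof
  show eq0: "dist x y = 0 \<longleftrightarrow> x = y" for x y :: gstar
    using balls_agree_eq_iff[of x y] by (auto simp: dist_gstar_def dloc_def)
  have pos: "dist x y \<ge> 0" for x y :: gstar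
    by (simp add: dist_gstar_def dloc_def)
  have pow: "\<exists>r. dist x y = 1 / 2 ^ r" if "x \<noteq> y" for x y :: gstar
    using that balls_agree_eq_iff[of x y] by (auto simp: dist_gstar_def dloc_def)
  have sym: "dist x y = dist y x" for x y :: gstar
  proof -
    have "balls_agree r x y \<longleftrightarrow> balls_agree r y x" for r using balls_agree_sym by blast
    then show ?thesis by (simp add: dist_gstar_def dloc_def)
  qed
  show "dist x y \<le> dist x z + dist y z" for x y z :: gstar
  proof (cases "x = z \<or> y = z")
    case True
    then show ?thesis using pos sym[of y z] sym[of x y] eq0 by auto
  next
    case False
    then obtain a b where ab: "dist x z = 1 / 2 ^ a" "dist y z = 1 / 2 ^ b" using pow by metis
    have "balls_agree a x z" "balls_agree b y z"
      using ab dloc_le_iff by (metis dist_gstar_def order_refl)+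
    then have "balls_agree (min a b) x y"
      using balls_agree_mono[of a x z "min a b"] balls_agree_mono[of b y z "min a b"]
        balls_agree_trans balls_agree_sym by (metis min.cobounded1 min.cobounded2)
    then have "dist x y \<le> 1 / 2 ^ min a b" by (simp add: dloc_le_iff dist_gstar_def)
    also have "\<dots> \<le> dist x z + dist y z" by (simp add: ab min_def)
    finally show ?thesis .
  qed
qed (rule uniformity_gstar_def open_gstar_def)+

end


section \<open>Random graphs and convergence in probability\<close>

definition conv_in_prob :: "(nat \<Rightarrow> 'w measure) \<Rightarrow> (nat \<Rightarrow> 'w \<Rightarrow> real) \<Rightarrow> real \<Rightarrow> bool" where
  "conv_in_prob M X c \<longleftrightarrow>
     (\<forall>\<epsilon>>0. (\<lambda>n. \<P>(\<omega> in M n. \<bar>X n \<omega> - c\<bar> > \<epsilon>)) \<longlonglongrightarrow> 0)"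

definition p_ball :: "nat \<Rightarrow> 'a graph \<Rightarrow> 'b rgraph \<Rightarrow> real" where
  "p_ball r g H = real (card {v \<in> verts g. nbhd r g v \<cong>\<^sub>* H}) / real (card (verts g))"

text \<open>Connected graphs \<open>H\<close> with uncountably many vertices need not be considered: for these (as for all
  infinite \<open>H\<close>) both sides are 0.\<close>

definition local_conv_in_prob ::
    "(nat \<Rightarrow> 'w measure) \<Rightarrow> (nat \<Rightarrow> 'w \<Rightarrow> nat graph) \<Rightarrow> 's measure \<Rightarrow> ('s \<Rightarrow> gstar) \<Rightarrow> bool" where
  "local_conv_in_prob M G N Gs \<longleftrightarrow>
     (\<forall>r. \<forall>H :: nat rgraph. connected_rgraph H \<longrightarrow>
        conv_in_prob M (\<lambda>n \<omega>. p_ball r (G n \<omega>) H) (\<P>(\<omega> in N. ball_iso r (Gs \<omega>) H)))"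

text \<open>There are only countably many finite graphs with vertices in \<^typ>\<open>nat\<close>, so the discrete
  \<open>\<sigma>\<close>-algebra is the appropriate one.\<close>

definition finite_graphs :: "nat \<Rightarrow> nat graph set" where
  "finite_graphs m = {g. simple_graph g \<and> finite (verts g) \<and> card (verts g) = m}"

text \<open>\<open>v\<close> is uniformly distributed on the vertex set of \<open>G\<close>, conditionally on \<open>G\<close>.\<close>

definition uniform_vertex :: "'w measure \<Rightarrow> ('w \<Rightarrow> nat graph) \<Rightarrow> ('w \<Rightarrow> nat) \<Rightarrow> bool" where
  "uniform_vertex M G v \<longleftrightarrow> v \<in> measurable M (count_space UNIV) \<and>
     (\<forall>g. \<P>(\<omega> in M. G \<omega> = g) \<noteq> 0 \<longrightarrow>
        (\<forall>x. \<P>(\<omega> in M. v \<omega> = x \<bar> G \<omega> = g) = pmf (pmf_of_set (verts g)) x))"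

end

theory Submission
  imports Defs
begin

text \<open>
  Write \<open>S k\<close> and \<open>Sh\<close> for the averages over the vertices \<open>v\<close> of \<open>(d v) ^ k\<close> and of
  \<open>hom' P4' g v = d v * (\<Sum>u\<sim>v. d u)\<close>. Rewriting the sums over edges as sums over vertices gives
  \<open>assortativity g = (S 1 * Sh - (S 2)\<^sup>2) / (S 1 * S 3 - (S 2)\<^sup>2)\<close>, so it suffices that the four averages
  converge in probability to the corresponding expectations. Truncating all degrees at \<open>K\<close> turns the summands into
  bounded functions of the 2-ball around \<open>v\<close>, and for these convergence follows from local convergence, as there
  are only countably many finite balls. For \<open>S 3\<close> the truncation is removed by convergence of the expectations.
  The truncation errors of the other averages are at most twice that of \<open>S 3\<close>; for \<open>Sh\<close> this uses
  \<open>d u * d v \<le> (d u)\<^sup>2 + (d v)\<^sup>2\<close> and the symmetry of adjacency.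
\<close>

section \<open>Convergence in probability\<close>

text \<open>Local convergence concerns the law of the ball conditionally on the graph, whereas the
  moment hypothesis concerns only an expectation over graph and vertex together. They meet in
  \<open>S 3\<close>: its truncations bound it from below, with limits arbitrarily close to the
  limit of its expectation, which leaves no room for a persistent excess. The difference between
  \<open>S 3\<close> and its truncation is then a single error that serves all the other averages.
  The obstacle is \<open>Sh\<close>. The number of paths at a vertex is not bounded by any function
  of its own degree, as a leaf next to a hub shows. Only the sum over all vertices is controlled by
  the cubes, because edges of a finite graph can be reversed. For the same reason the integrability
  of the path count in the limit is not read off at the root of \<open>G*\<close>: a bound that is
  uniform in \<open>K\<close> is proved in the finite graphs, carried to the limit for each
  \<open>K\<close>, and followed by monotone convergence.\<close>

lemma conv_in_probD:
  "conv_in_prob M X c \<Longrightarrow> \<epsilon> > 0 \<Longrightarrow> (\<lambda>n. \<P>(\<omega> in M n. \<bar>X n \<omega> - c\<bar> > \<epsilon>)) \<longlonglongrightarrow> 0"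
  unfolding conv_in_prob_def by blast

text \<open>This is a union bound: wherever \<open>Y n\<close> misses \<open>y\<close> by more than
  \<open>\<epsilon>\<close>, some member of \<open>F\<close> misses its limit by more than
  \<open>\<delta>\<close>. Since \<open>F\<close> and \<open>\<delta>\<close> may depend on
  \<open>\<epsilon>\<close>, a truncation level or a number of ball types can be fixed before
  \<open>n\<close> grows. Only the events of the members of \<open>F\<close> have to be measurable,
  as monotonicity of the measure asks this of the larger set.\<close>

lemma conv_in_prob_if_close:
  assumes M: "\<And>n. prob_space (M n)"
    and close: "\<And>\<epsilon>. \<epsilon> > 0 \<Longrightarrow> \<exists>F \<delta>. finite F \<and> \<delta> > 0 \<and>
      (\<forall>(X, c)\<in>F. (\<forall>n. X n \<in> borel_measurable (M n)) \<and> conv_in_prob M X c) \<and>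
      (\<forall>n. \<forall>\<omega>\<in>space (M n). (\<forall>(X, c)\<in>F. \<bar>X n \<omega> - c\<bar> \<le> \<delta>) \<longrightarrow> \<bar>Y n \<omega> - y\<bar> \<le> \<epsilon>)"
  shows "conv_in_prob M Y y"
  unfolding conv_in_prob_def
proof (intro allI impI)
  fix \<epsilon> :: real assume "\<epsilon> > 0"
  from close[OF this] obtain F \<delta> where F: "finite F" "\<delta> > 0"
    and *: "\<forall>(X, c)\<in>F. (\<forall>n. X n \<in> borel_measurable (M n)) \<and> conv_in_prob M X c"
      "\<forall>n. \<forall>\<omega>\<in>space (M n). (\<forall>(X, c)\<in>F. \<bar>X n \<omega> - c\<bar> \<le> \<delta>) \<longrightarrow> \<bar>Y n \<omega> - y\<bar> \<le> \<epsilon>"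
    by (elim exE conjE)
  have X: "\<And>X c n. (X, c) \<in> F \<Longrightarrow> X n \<in> borel_measurable (M n)"
      "\<And>X c. (X, c) \<in> F \<Longrightarrow> conv_in_prob M X c"
    using *(1) by auto
  have Y: "\<bar>Y n \<omega> - y\<bar> \<le> \<epsilon>"
    if "\<omega> \<in> space (M n)" "\<And>X c. (X, c) \<in> F \<Longrightarrow> \<bar>X n \<omega> - c\<bar> \<le> \<delta>" for n \<omega>
    using *(2) that by auto
  define E where "E p n = {\<omega> \<in> space (M n). \<bar>fst p n \<omega> - snd p\<bar> > \<delta>}" for p n
  have E: "E p n \<in> sets (M n)" if "p \<in> F" for p n
  proof -
    have [measurable]: "fst p n \<in> borel_measurable (M n)" using X(1)[of "fst p" "snd p"] that by simp
    show ?thesis unfolding E_def by measurable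
  qed
  have le: "\<P>(\<omega> in M n. \<bar>Y n \<omega> - y\<bar> > \<epsilon>) \<le> (\<Sum>p\<in>F. measure (M n) (E p n))" for n
  proof -
    interpret prob_space "M n" by (rule M)
    have "{\<omega> \<in> space (M n). \<bar>Y n \<omega> - y\<bar> > \<epsilon>} \<subseteq> (\<Union>p\<in>F. E p n)"
    proof
      fix \<omega> assume \<omega>: "\<omega> \<in> {\<omega> \<in> space (M n). \<bar>Y n \<omega> - y\<bar> > \<epsilon>}"
      then have "\<exists>X c. (X, c) \<in> F \<and> \<not> \<bar>X n \<omega> - c\<bar> \<le> \<delta>" using Y[of \<omega> n] by fastforce
      then show "\<omega> \<in> (\<Union>p\<in>F. E p n)" using \<omega> by (force simp: E_def)
    qed
    then have "prob {\<omega> \<in> space (M n). \<bar>Y n \<omega> - y\<bar> > \<epsilon>} \<le> prob (\<Union>p\<in>F. E p n)"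
      using E F(1) by (intro finite_measure_mono) auto
    also have "\<dots> \<le> (\<Sum>p\<in>F. prob (E p n))"
      using E F(1) by (intro finite_measure_subadditive_finite) auto
    finally show ?thesis .
  qed
  have lim: "(\<lambda>n. \<Sum>p\<in>F. measure (M n) (E p n)) \<longlonglongrightarrow> 0"
  proof (rule tendsto_null_sum)
    fix p assume "p \<in> F"
    then have "conv_in_prob M (fst p) (snd p)" using X(2) by simp
    then show "(\<lambda>n. measure (M n) (E p n)) \<longlonglongrightarrow> 0"
      unfolding E_def using F(2) by (rule conv_in_probD)
  qed
  show "(\<lambda>n. \<P>(\<omega> in M n. \<bar>Y n \<omega> - y\<bar> > \<epsilon>)) \<longlonglongrightarrow> 0"
    by (rule tendsto_sandwich[OF always_eventually always_eventually tendsto_const lim])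
      (intro allI le measure_nonneg)+
qed

lemma conv_in_prob_const: "conv_in_prob M (\<lambda>_ _. c) c"
  by (simp add: conv_in_prob_def)

lemma conv_in_prob_cong:
  assumes "conv_in_prob M X c" and eq: "\<And>n \<omega>. \<omega> \<in> space (M n) \<Longrightarrow> X n \<omega> = Y n \<omega>"
  shows "conv_in_prob M Y c"
proof -
  have "{\<omega> \<in> space (M n). \<bar>X n \<omega> - c\<bar> > \<epsilon>} = {\<omega> \<in> space (M n). \<bar>Y n \<omega> - c\<bar> > \<epsilon>}" for n \<epsilon>
    using eq by auto
  then show ?thesis using assms(1) unfolding conv_in_prob_def by simp
qed

text \<open>Continuity is asked only at the limit point, so that division is covered: the values
  that total division takes at other points do not matter.\<close>

lemma conv_in_prob_isCont:
  fixes f :: "real \<times> real \<Rightarrow> real"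
  assumes M: "\<And>n. prob_space (M n)"
    and X: "conv_in_prob M X a" "\<And>n. X n \<in> borel_measurable (M n)"
    and Y: "conv_in_prob M Y b" "\<And>n. Y n \<in> borel_measurable (M n)"
    and f: "isCont f (a, b)"
  shows "conv_in_prob M (\<lambda>n \<omega>. f (X n \<omega>, Y n \<omega>)) (f (a, b))"
proof (rule conv_in_prob_if_close[OF M])
  fix \<epsilon> :: real assume "\<epsilon> > 0"
  with f obtain \<delta> where \<delta>: "\<delta> > 0" "\<And>p. dist p (a, b) < \<delta> \<Longrightarrow> dist (f p) (f (a, b)) < \<epsilon>"
    by (auto simp: continuous_at_eps_delta)
  \<comment> \<open>Thirds are taken because two coordinate errors have to add up to strictly less
    than \<open>\<delta>\<close>.\<close>
  have "dist (x, y) (a, b) < \<delta>" if "\<bar>x - a\<bar> \<le> \<delta> / 3" "\<bar>y - b\<bar> \<le> \<delta> / 3" for x y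
  proof -
    have "dist (x, y) (a, b) \<le> \<bar>x - a\<bar> + \<bar>y - b\<bar>"
      using sqrt_sum_squares_le_sum_abs by (simp add: dist_Pair_Pair dist_real_def)
    then show ?thesis using that \<delta>(1) by simp
  qed
  then have "\<bar>f (x, y) - f (a, b)\<bar> \<le> \<epsilon>" if "\<bar>x - a\<bar> \<le> \<delta> / 3" "\<bar>y - b\<bar> \<le> \<delta> / 3" for x y
    using \<delta>(2) that by (fastforce simp: dist_real_def)
  then show "\<exists>F \<delta>. finite F \<and> \<delta> > 0 \<and>
      (\<forall>(X, c)\<in>F. (\<forall>n. X n \<in> borel_measurable (M n)) \<and> conv_in_prob M X c) \<and>
      (\<forall>n. \<forall>\<omega>\<in>space (M n). (\<forall>(X, c)\<in>F. \<bar>X n \<omega> - c\<bar> \<le> \<delta>) \<longrightarrow> \<bar>f (X n \<omega>, Y n \<omega>) - f (a, b)\<bar> \<le> \<epsilon>)"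
    using X Y \<delta>(1) by (intro exI[of _ "{(X, a), (Y, b)}"] exI[of _ "\<delta> / 3"]) auto
qed

lemma conv_in_prob_diff:
  assumes "\<And>n. prob_space (M n)"
    and "conv_in_prob M X a" "\<And>n. X n \<in> borel_measurable (M n)"
    and "conv_in_prob M Y b" "\<And>n. Y n \<in> borel_measurable (M n)"
  shows "conv_in_prob M (\<lambda>n \<omega>. X n \<omega> - Y n \<omega>) (a - b)"
  using conv_in_prob_isCont[OF assms, of "\<lambda>p. fst p - snd p"] by simp

lemma conv_in_prob_mult:
  assumes "\<And>n. prob_space (M n)"
    and "conv_in_prob M X a" "\<And>n. X n \<in> borel_measurable (M n)"
    and "conv_in_prob M Y b" "\<And>n. Y n \<in> borel_measurable (M n)"
  shows "conv_in_prob M (\<lambda>n \<omega>. X n \<omega> * Y n \<omega>) (a * b)"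
  using conv_in_prob_isCont[OF assms, of "\<lambda>p. fst p * snd p"] by simp

lemma conv_in_prob_divide:
  assumes "\<And>n. prob_space (M n)"
    and "conv_in_prob M X a" "\<And>n. X n \<in> borel_measurable (M n)"
    and "conv_in_prob M Y b" "\<And>n. Y n \<in> borel_measurable (M n)" and "b \<noteq> 0"
  shows "conv_in_prob M (\<lambda>n \<omega>. X n \<omega> / Y n \<omega>) (a / b)"
  using conv_in_prob_isCont[OF assms(1-5), of "\<lambda>p. fst p / snd p"] \<open>b \<noteq> 0\<close> by simp

text \<open>If \<open>b < a\<close>, then \<open>X n - Y n\<close>, which is never positive, stays
  at distance at least \<open>a - b\<close> from its limit on the whole space. The lemma transfers
  inequalities between averages over finite graphs to the limiting expectations.\<close>

lemma conv_in_prob_le: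
  assumes M: "\<And>n. prob_space (M n)"
    and X: "conv_in_prob M X a" "\<And>n. X n \<in> borel_measurable (M n)"
    and Y: "conv_in_prob M Y b" "\<And>n. Y n \<in> borel_measurable (M n)"
    and le: "\<And>n \<omega>. \<omega> \<in> space (M n) \<Longrightarrow> X n \<omega> \<le> Y n \<omega>"
  shows "a \<le> b"
proof (rule ccontr)
  assume "\<not> a \<le> b"
  then have "(a - b) / 2 > 0" by simp
  then have "(\<lambda>n. \<P>(\<omega> in M n. \<bar>X n \<omega> - Y n \<omega> - (a - b)\<bar> > (a - b) / 2)) \<longlonglongrightarrow> 0"
    by (rule conv_in_probD[OF conv_in_prob_diff[OF M X Y]])
  moreover have "\<P>(\<omega> in M n. \<bar>X n \<omega> - Y n \<omega> - (a - b)\<bar> > (a - b) / 2) = 1" for n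
  proof -
    interpret prob_space "M n" by (rule M)
    have "{\<omega> \<in> space (M n). \<bar>X n \<omega> - Y n \<omega> - (a - b)\<bar> > (a - b) / 2} = space (M n)"
      using le[of _ n] \<open>\<not> a \<le> b\<close> by (fastforce simp: field_simps abs_if)
    then show ?thesis by (simp add: prob_space)
  qed
  ultimately have "(\<lambda>n. 1 :: real) \<longlonglongrightarrow> 0" by (simp only:)
  then show False using LIMSEQ_unique[OF tendsto_const, of "1 :: real" 0] by simp
qed

text \<open>The level \<open>K\<close> is chosen before \<open>n\<close>. For fixed \<open>K\<close>
  the random error \<open>Z K\<close> need not vanish as \<open>n\<close> grows; it is enough that
  its limit \<open>z K\<close> is small. The four quarters of \<open>\<epsilon>\<close> are spent on
  \<open>z K\<close>, on \<open>Z K\<close> against \<open>z K\<close>, on \<open>X K\<close>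
  against \<open>c K\<close>, and on \<open>c K\<close> against \<open>y\<close>.\<close>

lemma conv_in_prob_approx:
  assumes M: "\<And>n. prob_space (M n)"
    and X: "\<And>K. conv_in_prob M (X K) (c K)" "\<And>K n. X K n \<in> borel_measurable (M n)"
    and Z: "\<And>K. conv_in_prob M (Z K) (z K)" "\<And>K n. Z K n \<in> borel_measurable (M n)"
    and le: "\<And>K n \<omega>. \<omega> \<in> space (M n) \<Longrightarrow> \<bar>Y n \<omega> - X K n \<omega>\<bar> \<le> Z K n \<omega>"
    and lim: "c \<longlonglongrightarrow> y" "z \<longlonglongrightarrow> 0"
  shows "conv_in_prob M Y y"
proof (rule conv_in_prob_if_close[OF M])
  fix \<epsilon> :: real assume \<epsilon>: "\<epsilon> > 0"
  have "\<forall>\<^sub>F K in sequentially. dist (c K) y < \<epsilon> / 4" "\<forall>\<^sub>F K in sequentially. dist (z K) 0 < \<epsilon> / 4"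
    using tendstoD[OF lim(1), of "\<epsilon> / 4"] tendstoD[OF lim(2), of "\<epsilon> / 4"] \<epsilon> by simp_all
  then have "\<forall>\<^sub>F K in sequentially. dist (c K) y < \<epsilon> / 4 \<and> dist (z K) 0 < \<epsilon> / 4"
    by eventually_elim simp
  then obtain K where K: "\<bar>c K - y\<bar> < \<epsilon> / 4" "\<bar>z K\<bar> < \<epsilon> / 4"
    unfolding dist_real_def by (auto simp: eventually_sequentially)
  have "\<bar>Y n \<omega> - y\<bar> \<le> \<epsilon>"
    if "\<omega> \<in> space (M n)" "\<bar>X K n \<omega> - c K\<bar> \<le> \<epsilon> / 4" "\<bar>Z K n \<omega> - z K\<bar> \<le> \<epsilon> / 4" for n \<omega>
    using le[OF that(1), of K] that(2,3) K by (simp add: abs_if split: if_splits)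
  then show "\<exists>F \<delta>. finite F \<and> \<delta> > 0 \<and>
      (\<forall>(X, c)\<in>F. (\<forall>n. X n \<in> borel_measurable (M n)) \<and> conv_in_prob M X c) \<and>
      (\<forall>n. \<forall>\<omega>\<in>space (M n). (\<forall>(X, c)\<in>F. \<bar>X n \<omega> - c\<bar> \<le> \<delta>) \<longrightarrow> \<bar>Y n \<omega> - y\<bar> \<le> \<epsilon>)"
    using X Z \<epsilon> by (intro exI[of _ "{(X K, c K), (Z K, z K)}"] exI[of _ "\<epsilon> / 4"]) auto
qed

text \<open>Scheffe's argument: \<open>E \<bar>Y - y\<bar> = E Y - y + 2 * E (max 0 (y - Y))\<close>, where the last integrand is bounded by
  \<open>y\<close> and tends to 0 in probability by the lower bounds \<open>X K\<close>.\<close>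

lemma conv_in_prob_if_expectation:
  assumes M: "\<And>n. prob_space (M n)"
    and Y: "\<And>n. integrable (M n) (Y n)" "\<And>n \<omega>. \<omega> \<in> space (M n) \<Longrightarrow> Y n \<omega> \<ge> 0"
    and E: "(\<lambda>n. integral\<^sup>L (M n) (Y n)) \<longlonglongrightarrow> y"
    and X: "\<And>K. conv_in_prob M (X K) (c K)" "\<And>K n. X K n \<in> borel_measurable (M n)"
      "\<And>K n \<omega>. \<omega> \<in> space (M n) \<Longrightarrow> X K n \<omega> \<le> Y n \<omega>"
    and c: "c \<longlonglongrightarrow> y"
  shows "conv_in_prob M Y y"
proof -
  define N where "N n \<omega> = max 0 (y - Y n \<omega>)" for n \<omega>
  have Ym [measurable]: "Y n \<in> borel_measurable (M n)" for n using Y(1) by auto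
  have y: "y \<ge> 0"
    using E Y(2) by (intro LIMSEQ_le_const[OF E]) (auto intro!: exI[of _ 0] integral_nonneg_AE)
  have Nint: "integrable (M n) (N n)" for n
  proof -
    interpret prob_space "M n" by (rule M)
    show ?thesis unfolding N_def using Y(1)[of n] by auto
  qed
  have N0: "(\<lambda>n. integral\<^sup>L (M n) (N n)) \<longlonglongrightarrow> 0"
  proof (rule LIMSEQ_I)
    fix \<epsilon> :: real assume \<epsilon>: "\<epsilon> > 0"
    have "\<forall>\<^sub>F K in sequentially. dist (c K) y < \<epsilon> / 4"
      using tendstoD[OF c, of "\<epsilon> / 4"] \<epsilon> by simp
    then obtain K where K: "\<bar>c K - y\<bar> < \<epsilon> / 4"
      unfolding dist_real_def by (auto simp: eventually_sequentially)
    let ?P = "\<lambda>n. \<P>(\<omega> in M n. \<bar>X K n \<omega> - c K\<bar> > \<epsilon> / 4)"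
    have "?P \<longlonglongrightarrow> 0" by (rule conv_in_probD[OF X(1)]) (use \<epsilon> in simp)
    \<comment> \<open>The summand 1 in \<open>y + 1\<close> keeps the threshold meaningful when
      \<open>y = 0\<close>.\<close>
    then have "\<forall>\<^sub>F n in sequentially. ?P n < \<epsilon> / (4 * (y + 1))"
      using \<epsilon> y by (intro order_tendstoD) auto
    then obtain n0 where n0: "\<And>n. n \<ge> n0 \<Longrightarrow> ?P n < \<epsilon> / (4 * (y + 1))"
      by (auto simp: eventually_sequentially)
    have "norm (integral\<^sup>L (M n) (N n) - 0) < \<epsilon>" if n: "n \<ge> n0" for n
    proof -
      interpret prob_space "M n" by (rule M)
      define E where "E = {\<omega> \<in> space (M n). \<bar>X K n \<omega> - c K\<bar> > \<epsilon> / 4}"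
      have [measurable]: "X K n \<in> borel_measurable (M n)" by (rule X(2))
      have E [measurable]: "E \<in> sets (M n)" unfolding E_def by measurable
      have i: "integrable (M n) (\<lambda>\<omega>. y * indicator E \<omega>)"
        using E by (intro integrable_mult_right integrable_real_indicator) (auto simp: emeasure_eq_measure)
      \<comment> \<open>Outside \<open>E\<close>, \<open>Y n\<close> is at least
        \<open>X K n \<ge> c K - \<epsilon> / 4 > y - \<epsilon> / 2\<close>. Inside
        \<open>E\<close>, \<open>Y n \<ge> 0\<close> leaves at most \<open>y\<close>.\<close>
      have "N n \<omega> \<le> \<epsilon> / 2 + y * indicator E \<omega>" if \<omega>: "\<omega> \<in> space (M n)" for \<omega>
        using Y(2)[OF \<omega>] X(3)[OF \<omega>, of K] K y \<epsilon> \<omega>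
        by (auto simp: N_def E_def indicator_def abs_if split: if_splits)
      then have "integral\<^sup>L (M n) (N n) \<le> (\<integral>\<omega>. \<epsilon> / 2 + y * indicator E \<omega> \<partial>M n)"
        using Nint i by (intro integral_mono integrable_add) auto
      also have "\<dots> = \<epsilon> / 2 + y * prob E"
        using i E sets.sets_into_space[OF E] by (simp add: prob_space Int_absorb2)
      also have "\<dots> = \<epsilon> / 2 + y * ?P n" by (simp only: E_def)
      also have "\<dots> \<le> \<epsilon> / 2 + (y + 1) * ?P n" by (simp add: algebra_simps)
      also have "\<dots> < \<epsilon> / 2 + (y + 1) * (\<epsilon> / (4 * (y + 1)))"
        using n0[OF n] y by (intro add_strict_left_mono mult_strict_left_mono) auto
      also have "(y + 1) * (\<epsilon> / (4 * (y + 1))) = \<epsilon> / 4" using y by (simp add: field_simps)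
      also have "\<epsilon> / 2 + \<epsilon> / 4 < \<epsilon>" using \<epsilon> by simp
      finally have "integral\<^sup>L (M n) (N n) < \<epsilon>" .
      moreover have "integral\<^sup>L (M n) (N n) \<ge> 0" by (simp add: N_def)
      ultimately show ?thesis by simp
    qed
    then show "\<exists>n0. \<forall>n\<ge>n0. norm (integral\<^sup>L (M n) (N n) - 0) < \<epsilon>" by blast
  qed
  have abs: "(\<integral>\<omega>. \<bar>Y n \<omega> - y\<bar> \<partial>M n) = integral\<^sup>L (M n) (Y n) - y + 2 * integral\<^sup>L (M n) (N n)" for n
  proof -
    interpret prob_space "M n" by (rule M)
    have "\<bar>Y n \<omega> - y\<bar> = Y n \<omega> - y + 2 * N n \<omega>" for \<omega> by (simp add: N_def max_def)
    then have "(\<integral>\<omega>. \<bar>Y n \<omega> - y\<bar> \<partial>M n) = (\<integral>\<omega>. Y n \<omega> - y + 2 * N n \<omega> \<partial>M n)" by simp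
    then show ?thesis using Y(1)[of n] Nint[of n] by (simp add: prob_space)
  qed
  have lim: "(\<lambda>n. \<integral>\<omega>. \<bar>Y n \<omega> - y\<bar> \<partial>M n) \<longlonglongrightarrow> 0"
    unfolding abs by (rule tendsto_eq_intros E N0 refl)+ simp
  show ?thesis
    unfolding conv_in_prob_def
  proof (intro allI impI)
    fix \<epsilon> :: real assume \<epsilon>: "\<epsilon> > 0"
    have le: "\<P>(\<omega> in M n. \<bar>Y n \<omega> - y\<bar> > \<epsilon>) \<le> (\<integral>\<omega>. \<bar>Y n \<omega> - y\<bar> \<partial>M n) / \<epsilon>" for n
    proof -
      interpret prob_space "M n" by (rule M)
      have "prob {\<omega> \<in> space (M n). \<bar>Y n \<omega> - y\<bar> > \<epsilon>} \<le> prob {\<omega> \<in> space (M n). \<bar>Y n \<omega> - y\<bar> \<ge> \<epsilon>}"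
        by (intro finite_measure_mono) (auto intro: less_imp_le)
      also have "\<dots> \<le> (\<integral>\<omega>. \<bar>Y n \<omega> - y\<bar> \<partial>M n) / \<epsilon>"
        using Y(1)[of n] \<epsilon> by (intro integral_Markov_inequality_measure[where A="{}"]) auto
      finally show ?thesis .
    qed
    have lim': "(\<lambda>n. (\<integral>\<omega>. \<bar>Y n \<omega> - y\<bar> \<partial>M n) / \<epsilon>) \<longlonglongrightarrow> 0"
      using tendsto_divide[OF lim tendsto_const, of \<epsilon>] \<epsilon> by simp
    show "(\<lambda>n. \<P>(\<omega> in M n. \<bar>Y n \<omega> - y\<bar> > \<epsilon>)) \<longlonglongrightarrow> 0"
      by (rule tendsto_sandwich[OF always_eventually always_eventually tendsto_const lim'])
        (intro allI le measure_nonneg)+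
  qed
qed

text \<open>The variable and the finite sum agree where \<open>A < I\<close> and differ by at most
  \<open>B\<close> elsewhere. The probability of the tail is written as 1 minus the first
  \<open>I\<close> atoms, so that convergence of finitely many atoms already controls it. The lemma
  serves both the limit and, with the uniform distribution on the vertices, each fixed finite
  graph.\<close>

lemma (in prob_space) expectation_truncated_sum:
  fixes A :: "'a \<Rightarrow> nat" and \<psi> :: "nat \<Rightarrow> real"
  assumes A [measurable]: "A \<in> measurable M (count_space UNIV)" and B: "\<And>i. \<bar>\<psi> i\<bar> \<le> B"
  shows "\<bar>expectation (\<lambda>\<omega>. \<psi> (A \<omega>)) - (\<Sum>i<I. \<psi> i * \<P>(\<omega> in M. A \<omega> = i))\<bar> \<le>
    B * (1 - (\<Sum>i<I. \<P>(\<omega> in M. A \<omega> = i)))"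
proof -
  define E where "E i = {\<omega> \<in> space M. A \<omega> = i}" for i
  have E: "E i \<in> sets M" for i unfolding E_def by measurable
  have ind: "integrable M (indicator (E i) :: 'a \<Rightarrow> real)" "expectation (indicator (E i)) = prob (E i)" for i
    using E sets.sets_into_space[OF E, of i] by (auto simp: emeasure_eq_measure Int_absorb2)
  have int: "integrable M (\<lambda>\<omega>. \<psi> (A \<omega>))"
    by (rule integrable_const_bound[where B = B]) (use B in auto)
  have intS: "integrable M (\<lambda>\<omega>. \<Sum>i<I. c i * indicator (E i) \<omega>)" for c :: "nat \<Rightarrow> real"
    using ind(1) by (intro Bochner_Integration.integrable_sum integrable_mult_right)
  have expS: "expectation (\<lambda>\<omega>. \<Sum>i<I. c i * indicator (E i) \<omega>) = (\<Sum>i<I. c i * prob (E i))" for c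
    using ind by (subst Bochner_Integration.integral_sum) (auto intro!: integrable_mult_right)
  have one: "(\<Sum>i<I. c i * indicator (E i) \<omega>) = (if A \<omega> < I then c (A \<omega>) else 0)"
    if "\<omega> \<in> space M" for \<omega> and c :: "nat \<Rightarrow> real"
  proof -
    have "(\<Sum>i<I. c i * indicator (E i) \<omega>) = (\<Sum>i<I. if A \<omega> = i then c i else 0)"
      using that by (intro sum.cong) (auto simp: E_def indicator_def)
    then show ?thesis by simp
  qed
  have "expectation (\<lambda>\<omega>. \<psi> (A \<omega>)) - (\<Sum>i<I. \<psi> i * prob (E i)) =
      expectation (\<lambda>\<omega>. \<psi> (A \<omega>) - (\<Sum>i<I. \<psi> i * indicator (E i) \<omega>))"
    unfolding Bochner_Integration.integral_diff[OF int intS] expS ..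
  also have "\<bar>\<dots>\<bar> \<le> expectation (\<lambda>\<omega>. \<bar>\<psi> (A \<omega>) - (\<Sum>i<I. \<psi> i * indicator (E i) \<omega>)\<bar>)"
    by (rule integral_abs_bound)
  also have "\<dots> \<le> expectation (\<lambda>\<omega>. B * (1 - (\<Sum>i<I. 1 * indicator (E i) \<omega>)))"
  proof (rule integral_mono)
    show "integrable M (\<lambda>\<omega>. \<bar>\<psi> (A \<omega>) - (\<Sum>i<I. \<psi> i * indicator (E i) \<omega>)\<bar>)"
      by (intro integrable_abs Bochner_Integration.integrable_diff int intS)
    show "integrable M (\<lambda>\<omega>. B * (1 - (\<Sum>i<I. 1 * indicator (E i) \<omega>)))"
      by (intro integrable_mult_right Bochner_Integration.integrable_diff intS) simp
    fix \<omega> assume \<omega>: "\<omega> \<in> space M"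
    show "\<bar>\<psi> (A \<omega>) - (\<Sum>i<I. \<psi> i * indicator (E i) \<omega>)\<bar> \<le> B * (1 - (\<Sum>i<I. 1 * indicator (E i) \<omega>))"
      unfolding one[OF \<omega>] using B by simp
  qed
  also have "\<dots> = B * (1 - (\<Sum>i<I. prob (E i)))"
    using Bochner_Integration.integral_diff[OF integrable_const intS, of 1 "\<lambda>_. 1"] expS[of "\<lambda>_. 1"]
    by (simp add: prob_space)
  finally show ?thesis unfolding E_def .
qed

lemma (in prob_space) prob_nat_sums:
  fixes A :: "'a \<Rightarrow> nat"
  assumes [measurable]: "A \<in> measurable M (count_space UNIV)"
  shows "(\<lambda>i. \<P>(\<omega> in M. A \<omega> = i)) sums 1"
proof -
  have "(\<lambda>i. prob {\<omega> \<in> space M. A \<omega> = i}) sums prob (\<Union>i. {\<omega> \<in> space M. A \<omega> = i})"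
    by (rule finite_measure_UNION) (auto simp: disjoint_family_on_def)
  also have "(\<Union>i. {\<omega> \<in> space M. A \<omega> = i}) = space M" by auto
  finally show ?thesis by (simp add: prob_space)
qed

section \<open>Degrees, homomorphisms and truncation\<close>

definition neighbours :: "'a graph \<Rightarrow> 'a \<Rightarrow> 'a set" where
  "neighbours g v = {u. (v, u) \<in> adj g}"

lemma card_neighbours: "card (neighbours g v) = vertex_degree g v"
  by (simp add: neighbours_def vertex_degree_def)

lemma adj_commute: "(u, v) \<in> adj g \<longleftrightarrow> (v, u) \<in> adj g"
  by (simp add: adj_def insert_commute)

lemma neighbours_verts: "simple_graph g \<Longrightarrow> neighbours g v \<subseteq> verts g"
  using adj_verts by (fastforce simp: neighbours_def)

lemma locally_finite_if_finite:
  assumes "simple_graph g" "finite (verts g)"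
  shows "locally_finite g"
  unfolding locally_finite_def
  using finite_subset[OF neighbours_verts[OF assms(1)] assms(2)] by (simp add: neighbours_def)

lemma adj_eq_Sigma: "simple_graph g \<Longrightarrow> adj g = Sigma (verts g) (neighbours g)"
  using adj_verts by (fastforce simp: neighbours_def)

lemma sum_adj:
  fixes f :: "'a \<Rightarrow> 'a \<Rightarrow> 'c :: comm_monoid_add"
  assumes "simple_graph g" "finite (verts g)"
  shows "(\<Sum>(u, v)\<in>adj g. f u v) = (\<Sum>u\<in>verts g. \<Sum>v\<in>neighbours g u. f u v)"
  unfolding adj_eq_Sigma[OF assms(1)]
  using assms finite_subset[OF neighbours_verts[OF assms(1)] assms(2)]
  by (subst sum.Sigma) auto

lemma sum_adj_swap: "(\<Sum>(u, v)\<in>adj g. f v u) = (\<Sum>(u, v)\<in>adj g. f u v)"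
  by (rule sum.reindex_bij_witness[of _ prod.swap prod.swap]) (auto simp: adj_commute)

text \<open>The map from ordered adjacent pairs to edges is two-to-one, because the ends of an edge
  are distinct.\<close>

lemma card_adj:
  assumes "simple_graph g" "finite (verts g)"
  shows "card (adj g) = 2 * card (edges g)"
proof -
  have fin: "finite (edges g)"
    using assms finite_subset[of "edges g" "Pow (verts g)"] by (auto simp: simple_graph_def)
  have fib: "card {p. {fst p, snd p} = e} = 2" if "e \<in> edges g" for e
  proof -
    have "card e = 2" using that assms(1) by (simp add: simple_graph_def)
    then obtain a b where "e = {a, b}" "a \<noteq> b" unfolding card_2_iff by blast
    then have "{p. {fst p, snd p} = e} = {(a, b), (b, a)}"
      by (auto simp: doubleton_eq_iff)
    then show ?thesis using \<open>a \<noteq> b\<close> by simp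
  qed
  then have fin': "finite {p. {fst p, snd p} = e}" if "e \<in> edges g" for e
    using fib[OF that] by (intro card_ge_0_finite) simp
  have "adj g = (\<Union>e\<in>edges g. {p. {fst p, snd p} = e})"
    by (auto simp: adj_def)
  then have "card (adj g) = (\<Sum>e\<in>edges g. card {p. {fst p, snd p} = e})"
    using fin fin' by (simp add: card_UN_disjoint disjoint_iff)
  then show ?thesis using fib by simp
qed

text \<open>Vertex 1 goes to \<open>v\<close> and vertex 2 to a neighbour \<open>u\<close>; the ends
  0 and 3 are then chosen independently among the neighbours of \<open>v\<close> and of
  \<open>u\<close>. A homomorphism may fold the path back, so no choice is excluded and the count is
  a plain product.\<close>

lemma hom'_P4':
  assumes g: "simple_graph g" "locally_finite g" and v: "v \<in> verts g"
  shows "hom' P4' g v = (\<Sum>u\<in>neighbours g v. vertex_degree g v * vertex_degree g u)"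
proof -
  let ?N = "neighbours g"
  have fin: "finite (?N u)" if "u \<in> verts g" for u
    using g(2) that by (simp add: locally_finite_def neighbours_def)
  have nv: "u \<in> verts g" if "u \<in> ?N w" for u w
    using neighbours_verts[OF g(1)] that by blast
  let ?A = "{f \<in> verts (graph_of P4') \<rightarrow>\<^sub>E verts g. f (root P4') = v \<and>
     (\<forall>x y. {x, y} \<in> edges (graph_of P4') \<longrightarrow> {f x, f y} \<in> edges g)}"
  let ?B = "Sigma (?N v) (\<lambda>u. ?N v \<times> ?N u)"
  have edges_iff: "(\<forall>x y. {x, y} \<in> edges (graph_of P4') \<longrightarrow> {f x, f y} \<in> edges g) \<longleftrightarrow>
      f 0 \<in> ?N (f 1) \<and> f 2 \<in> ?N (f 1) \<and> f 3 \<in> ?N (f 2)" for f :: "nat \<Rightarrow> _"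
    by (auto simp: P4'_def neighbours_def adj_def doubleton_eq_iff insert_commute)
  \<comment> \<open>Updating the constant \<open>undefined\<close> makes the map extensional, as
    membership in \<open>\<rightarrow>\<^sub>E\<close> requires.\<close>
  let ?g = "\<lambda>(u, a, w). (\<lambda>i :: nat. undefined)(0 := a, 1 := v, 2 := u, 3 := w)"
  have "bij_betw (\<lambda>f. (f 2, f 0, f 3)) ?A ?B"
  proof (rule bij_betwI[where g = ?g])
    show "(\<lambda>f. (f 2, f 0, f 3)) \<in> ?A \<rightarrow> ?B"
      unfolding edges_iff by (auto simp: P4'_def)
    show "?g \<in> ?B \<rightarrow> ?A"
    proof
      fix p assume "p \<in> ?B"
      then obtain u a w where p: "p = (u, a, w)" "u \<in> ?N v" "a \<in> ?N v" "w \<in> ?N u" by auto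
      then have "?g p \<in> {0, 1, 2, 3} \<rightarrow>\<^sub>E verts g"
        using nv v by (intro PiE_I) auto
      then show "?g p \<in> ?A" unfolding edges_iff using p by (simp add: P4'_def)
    qed
    show "?g (f 2, f 0, f 3) = f" if "f \<in> ?A" for f
    proof
      fix i
      have "f \<in> extensional {0, 1, 2, 3}" "f 1 = v" using that by (auto simp: P4'_def PiE_def)
      then show "?g (f 2, f 0, f 3) i = f i" by (auto simp: extensional_def)
    qed
  qed auto
  then have "hom' P4' g v = card ?B"
    unfolding hom'_def by (rule bij_betw_same_card)
  also have "\<dots> = (\<Sum>u\<in>?N v. card (?N v \<times> ?N u))"
    using fin nv v by (intro card_SigmaI) auto
  finally show ?thesis by (simp add: card_cartesian_product card_neighbours)
qed

text \<open>Cutting off to 0, instead of capping the degree at \<open>K\<close>, keeps the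
  truncation multiplicative: the degree times the truncated square is the truncated cube. Sums over
  edges therefore become sums over vertices without an error term.\<close>

definition trunc_degree_power :: "nat \<Rightarrow> nat \<Rightarrow> 'a graph \<Rightarrow> 'a \<Rightarrow> real" where
  "trunc_degree_power K k g v = (if vertex_degree g v \<le> K then real (vertex_degree g v) ^ k else 0)"

text \<open>Each end of the middle edge carries a truncated degree. The factor of \<open>v\<close>
  also limits the number of nonzero summands to \<open>K\<close>, as it vanishes when
  \<open>v\<close> has more than \<open>K\<close> neighbours; hence the bound \<open>K ^ 3\<close>
  below.\<close>

definition trunc_hom :: "nat \<Rightarrow> 'a graph \<Rightarrow> 'a \<Rightarrow> real" where
  "trunc_hom K g v = (\<Sum>u\<in>neighbours g v. trunc_degree_power K 1 g v * trunc_degree_power K 1 g u)"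

section \<open>Invariance and locality of the truncated functionals\<close>

lemma neighbours_iso:
  assumes R: "simple_graph (graph_of R)" "simple_graph (graph_of S)" and f: "is_rooted_iso f R S"
    and u: "u \<in> verts (graph_of R)"
  shows "neighbours (graph_of S) (f u) = f ` neighbours (graph_of R) u"
proof -
  have b: "f ` verts (graph_of R) = verts (graph_of S)"
    using f by (auto simp: is_rooted_iso_def bij_betw_def)
  have iff: "f w \<in> neighbours (graph_of S) (f u) \<longleftrightarrow> w \<in> neighbours (graph_of R) u"
    if "w \<in> verts (graph_of R)" for w
    using f u that by (auto simp: is_rooted_iso_def neighbours_def adj_def)
  show ?thesis
  proof (intro equalityI subsetI)
    fix y assume y: "y \<in> neighbours (graph_of S) (f u)"
    then obtain w where "w \<in> verts (graph_of R)" "y = f w"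
      using neighbours_verts[OF R(2)] b by blast
    then show "y \<in> f ` neighbours (graph_of R) u" using iff y by blast
  next
    fix y assume "y \<in> f ` neighbours (graph_of R) u"
    then show "y \<in> neighbours (graph_of S) (f u)" using iff neighbours_verts[OF R(1)] by blast
  qed
qed

lemma vertex_degree_iso:
  assumes "simple_graph (graph_of R)" "simple_graph (graph_of S)" and f: "is_rooted_iso f R S"
    and "u \<in> verts (graph_of R)"
  shows "vertex_degree (graph_of S) (f u) = vertex_degree (graph_of R) u"
proof -
  have "inj_on f (verts (graph_of R))"
    using f by (simp add: is_rooted_iso_def bij_betw_def)
  then have "inj_on f (neighbours (graph_of R) u)"
    using neighbours_verts[OF assms(1)] by (rule inj_on_subset)
  then show ?thesis
    using neighbours_iso[OF assms] by (simp add: card_image flip: card_neighbours)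
qed

lemma trunc_hom_iso:
  assumes R: "simple_graph (graph_of R)" "simple_graph (graph_of S)" and f: "is_rooted_iso f R S"
    and u: "u \<in> verts (graph_of R)"
  shows "trunc_hom K (graph_of S) (f u) = trunc_hom K (graph_of R) u"
proof -
  have t: "trunc_degree_power K 1 (graph_of S) (f w) = trunc_degree_power K 1 (graph_of R) w"
    if "w \<in> verts (graph_of R)" for w
    using vertex_degree_iso[OF R f that] by (simp add: trunc_degree_power_def)
  have "inj_on f (verts (graph_of R))"
    using f by (simp add: is_rooted_iso_def bij_betw_def)
  then have inj: "inj_on f (neighbours (graph_of R) u)"
    using neighbours_verts[OF R(1)] by (rule inj_on_subset)
  show ?thesis
    unfolding trunc_hom_def neighbours_iso[OF R f u] sum.reindex[OF inj] comp_def t[OF u]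
    using t neighbours_verts[OF R(1), of u] by (intro sum.cong refl) auto
qed

text \<open>The neighbours of a vertex reached in \<open>k < r\<close> steps are reached in at most
  \<open>r\<close> steps, so only the boundary of a ball can lose edges. Reading the degrees of the
  neighbours of the root, one step away, thus takes radius 2.\<close>

lemma neighbours_nbhd:
  assumes g: "simple_graph g" "v \<in> verts g" and u: "(v, u) \<in> adj g ^^ k" "k < r"
  shows "neighbours (graph_of (nbhd r g v)) u = neighbours g u"
proof -
  have mem: "w \<in> verts (graph_of (nbhd r g v))" if "(v, w) \<in> adj g ^^ j" "j \<le> r" for w j
    using that relpow_verts[OF g] unfolding verts_nbhd by blast
  have "u \<in> verts (graph_of (nbhd r g v))" using mem u by simp
  moreover have "w \<in> verts (graph_of (nbhd r g v))" if "w \<in> neighbours g u" for w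
    using mem[of w "Suc k"] that u by (auto simp: neighbours_def)
  moreover have "neighbours (graph_of (nbhd r g v)) u \<subseteq> neighbours g u"
    by (auto simp: neighbours_def adj_def nbhd_def induced_def)
  ultimately show ?thesis
    by (auto simp: neighbours_def adj_def edges_nbhd)
qed

lemma trunc_degree_power_nbhd:
  assumes "simple_graph g" "v \<in> verts g" "(v, u) \<in> adj g ^^ k" "k < r"
  shows "trunc_degree_power K j (graph_of (nbhd r g v)) u = trunc_degree_power K j g u"
  using neighbours_nbhd[OF assms] by (simp add: trunc_degree_power_def flip: card_neighbours)

lemma trunc_hom_nbhd:
  assumes g: "simple_graph g" "v \<in> verts g"
  shows "trunc_hom K (graph_of (nbhd 2 g v)) v = trunc_hom K g v"
proof -
  have v: "(v, v) \<in> adj g ^^ 0" by simp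
  have "(v, u) \<in> adj g ^^ 1" if "u \<in> neighbours g v" for u using that by (simp add: neighbours_def)
  then show ?thesis
    using trunc_degree_power_nbhd[OF g, of _ 1 2] trunc_degree_power_nbhd[OF g v, of 2] neighbours_nbhd[OF g v, of 2]
    by (simp add: trunc_hom_def)
qed

section \<open>Bounds for the truncated functionals and their errors\<close>

lemma trunc_degree_power_nonneg: "trunc_degree_power K k g v \<ge> 0"
  by (simp add: trunc_degree_power_def)

lemma trunc_degree_power_le: "trunc_degree_power K k g v \<le> real K ^ k"
  by (simp add: trunc_degree_power_def power_mono)

lemma trunc_hom_nonneg: "trunc_hom K g v \<ge> 0"
  by (simp add: trunc_hom_def sum_nonneg trunc_degree_power_nonneg)

lemma trunc_hom_le: "trunc_hom K g v \<le> real K ^ 3"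
proof (cases "vertex_degree g v \<le> K")
  case True
  have "trunc_hom K g v \<le> (\<Sum>u\<in>neighbours g v. real K * real K)"
    unfolding trunc_hom_def using trunc_degree_power_le[of K 1 g] trunc_degree_power_nonneg[of K 1 g]
    by (intro sum_mono mult_mono) auto
  also have "\<dots> = real (vertex_degree g v) * (real K * real K)"
    by (simp add: card_neighbours)
  also have "\<dots> \<le> real K * (real K * real K)"
    using True by (intro mult_right_mono) auto
  finally show ?thesis by (simp add: power3_eq_cube mult.assoc)
qed (simp add: trunc_hom_def trunc_degree_power_def)

text \<open>The inequality fails vertex by vertex, for instance at a leaf next to a vertex of larger
  degree below the cutoff; it appears only after exchanging the ends of the edges in the sum. Its
  right side does not depend on \<open>K\<close>, which is what makes the path count of the limit
  integrable.\<close>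

lemma sum_trunc_hom_le:
  assumes g: "simple_graph g" "finite (verts g)"
  shows "(\<Sum>v\<in>verts g. trunc_hom K g v) \<le> (\<Sum>v\<in>verts g. real (vertex_degree g v) ^ 3)"
proof -
  let ?d = "\<lambda>v. real (vertex_degree g v)" and ?t = "trunc_degree_power K 1 g"
  have "2 * (\<Sum>v\<in>verts g. trunc_hom K g v) = (\<Sum>(u, v)\<in>adj g. 2 * (?t u * ?t v))"
    unfolding trunc_hom_def sum_adj[OF g, symmetric] by (simp add: sum_distrib_left case_prod_beta)
  also have "\<dots> \<le> (\<Sum>(u, v)\<in>adj g. (?d u)\<^sup>2 + (?d v)\<^sup>2)"
  proof (rule sum_mono, clarify)
    fix u v
    have "2 * (?t u * ?t v) \<le> 2 * (?d u * ?d v)"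
      using mult_mono[of "?t u" "?d u" "?t v" "?d v"] by (simp add: trunc_degree_power_def)
    also have "\<dots> \<le> (?d u)\<^sup>2 + (?d v)\<^sup>2" using sum_squares_bound[of "?d u" "?d v"] by simp
    finally show "2 * (?t u * ?t v) \<le> (?d u)\<^sup>2 + (?d v)\<^sup>2" .
  qed
  also have "\<dots> = (\<Sum>(u, v)\<in>adj g. (?d u)\<^sup>2) + (\<Sum>(u, v)\<in>adj g. (?d v)\<^sup>2)"
    by (simp add: sum.distrib case_prod_beta)
  also have "\<dots> = 2 * (\<Sum>(u, v)\<in>adj g. (?d u)\<^sup>2)"
    using sum_adj_swap[of "\<lambda>u v. (?d u)\<^sup>2" g] by simp
  also have "\<dots> = 2 * (\<Sum>v\<in>verts g. ?d v ^ 3)"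
    unfolding sum_adj[OF g] by (simp add: card_neighbours power3_eq_cube power2_eq_square mult.assoc)
  finally show ?thesis by simp
qed

text \<open>If an edge \<open>uv\<close> is lost by the truncation, then the end \<open>w\<close> of larger degree satisfies
  \<open>d u * d v \<le> (d w)\<^sup>2\<close> and \<open>d w > K\<close>.\<close>

lemma sum_hom_diff_trunc_le:
  assumes g: "simple_graph g" "finite (verts g)"
  shows "(\<Sum>v\<in>verts g. real (hom' P4' g v) - trunc_hom K g v) \<le>
    2 * (\<Sum>v\<in>verts g. real (vertex_degree g v) ^ 3 - trunc_degree_power K 3 g v)"
proof -
  let ?d = "\<lambda>v. real (vertex_degree g v)" and ?t = "trunc_degree_power K"
  have lf: "locally_finite g" by (rule locally_finite_if_finite[OF g])
  have "(\<Sum>v\<in>verts g. real (hom' P4' g v) - trunc_hom K g v) = (\<Sum>(u, v)\<in>adj g. ?d u * ?d v - ?t 1 g u * ?t 1 g v)"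
    unfolding sum_adj[OF g] by (intro sum.cong refl) (simp add: hom'_P4'[OF g(1) lf] trunc_hom_def sum_subtractf)
  also have "\<dots> \<le> (\<Sum>(u, v)\<in>adj g. ((?d u)\<^sup>2 - ?t 2 g u) + ((?d v)\<^sup>2 - ?t 2 g v))"
  proof (rule sum_mono, clarify)
    fix u v
    consider "?d u \<le> K" "?d v \<le> K" | "?d u \<le> ?d v" "?d v > K" | "?d v \<le> ?d u" "?d u > K" by linarith
    then show "?d u * ?d v - ?t 1 g u * ?t 1 g v \<le> ((?d u)\<^sup>2 - ?t 2 g u) + ((?d v)\<^sup>2 - ?t 2 g v)"
    proof cases
      case 2
      then have "?d u * ?d v \<le> (?d v)\<^sup>2" by (simp add: power2_eq_square mult_right_mono)
      moreover from this have "?d u * ?d v \<le> (?d u)\<^sup>2 + (?d v)\<^sup>2" by (simp add: add_increasing)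
      ultimately show ?thesis using 2 by (auto simp: trunc_degree_power_def)
    next
      case 3
      then have "?d u * ?d v \<le> (?d u)\<^sup>2" by (simp add: power2_eq_square mult_left_mono)
      moreover from this have "?d u * ?d v \<le> (?d u)\<^sup>2 + (?d v)\<^sup>2" by (simp add: add_increasing2)
      ultimately show ?thesis using 3 by (auto simp: trunc_degree_power_def)
    qed (auto simp: trunc_degree_power_def)
  qed
  also have "\<dots> = (\<Sum>(u, v)\<in>adj g. (?d u)\<^sup>2 - ?t 2 g u) + (\<Sum>(u, v)\<in>adj g. (?d v)\<^sup>2 - ?t 2 g v)"
    by (simp add: sum.distrib case_prod_beta)
  also have "\<dots> = 2 * (\<Sum>(u, v)\<in>adj g. (?d u)\<^sup>2 - ?t 2 g u)"
    using sum_adj_swap[of "\<lambda>u v. (?d u)\<^sup>2 - ?t 2 g u" g] by simp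
  also have "(\<Sum>(u, v)\<in>adj g. (?d u)\<^sup>2 - ?t 2 g u) = (\<Sum>v\<in>verts g. ?d v ^ 3 - ?t 3 g v)"
    unfolding sum_adj[OF g]
    by (intro sum.cong) (auto simp: card_neighbours trunc_degree_power_def power3_eq_cube power2_eq_square)
  finally show ?thesis .
qed

lemma trunc_hom_le_hom':
  assumes "simple_graph g" "locally_finite g" "v \<in> verts g"
  shows "trunc_hom K g v \<le> real (hom' P4' g v)"
  unfolding hom'_P4'[OF assms] trunc_hom_def of_nat_sum of_nat_mult
  by (intro sum_mono mult_mono) (auto simp: trunc_degree_power_def)

text \<open>For a nonempty finite graph this is the expectation of \<open>F\<close> at a uniform
  vertex, that is, the conditional expectation given the graph.\<close>

definition vertex_avg :: "'a graph \<Rightarrow> ('a \<Rightarrow> real) \<Rightarrow> real" where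
  "vertex_avg g F = (\<Sum>v\<in>verts g. F v) / real (card (verts g))"

text \<open>Numerator and denominator both carry the factor
  \<open>c = n\<^sup>2 / (2 * e)\<^sup>2\<close>, which cancels. There are no exceptional graphs:
  without edges all averages on the right vanish, and if the variance is 0 then so is the
  denominator on the right; in both cases division by 0 agrees with the convention for
  \<open>assortativity\<close>.\<close>

lemma assortativity_eq:
  assumes g: "simple_graph g" "finite (verts g)"
  defines "S \<equiv> \<lambda>k. vertex_avg g (\<lambda>v. real (vertex_degree g v) ^ k)"
  shows "assortativity g =
    (S 1 * vertex_avg g (\<lambda>v. real (hom' P4' g v)) - (S 2)\<^sup>2) / (S 1 * S 3 - (S 2)\<^sup>2)"
proof (cases "card (verts g) = 0 \<or> card (edges g) = 0")
  case True
  moreover have "edges g = {}" if "verts g = {}"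
    using g(1) that by (fastforce simp: simple_graph_def)
  ultimately have "card (adj g) = 0" using card_adj[OF g] g(2) by auto
  moreover have "finite (adj g)"
    using g finite_subset[of "adj g" "verts g \<times> verts g"] adj_verts by fastforce
  ultimately have "vertex_degree g v = 0" for v by (simp add: vertex_degree_def)
  moreover have "card (edges g) = 0" using \<open>card (adj g) = 0\<close> card_adj[OF g] by simp
  ultimately show ?thesis by (simp add: S_def vertex_avg_def assortativity_def power_0_left)
next
  case False
  define n where "n = real (card (verts g))"
  define e where "e = real (card (edges g))"
  have n: "n \<noteq> 0" "e \<noteq> 0" using False by (auto simp: n_def e_def)
  let ?d = "\<lambda>v. real (vertex_degree g v)"
  have "2 * e = real (card (adj g))" by (simp add: card_adj[OF g] e_def)
  also have "\<dots> = (\<Sum>(u, v)\<in>adj g. 1)" by (simp add: case_prod_beta)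
  also have "\<dots> = (\<Sum>v\<in>verts g. ?d v)" unfolding sum_adj[OF g] by (simp add: card_neighbours)
  finally have S1: "n * S 1 = 2 * e" using n by (simp add: S_def vertex_avg_def n_def)
  have b: "assort_b g = n * S 2 / (2 * e)"
    using n unfolding assort_b_def sum_adj[OF g]
    by (simp add: card_neighbours S_def vertex_avg_def power2_eq_square flip: n_def e_def)
  have b': "assort_b' g = n * S 3 / (2 * e)"
    using n unfolding assort_b'_def sum_adj[OF g]
    by (simp add: card_neighbours S_def vertex_avg_def power2_eq_square power3_eq_cube mult.assoc flip: n_def e_def)
  define Sh where "Sh = vertex_avg g (\<lambda>v. real (hom' P4' g v))"
  have lf: "locally_finite g" by (rule locally_finite_if_finite[OF g])
  have gg: "assort_g g = n * Sh / (2 * e)"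
    using n unfolding assort_g_def sum_adj[OF g]
    by (simp add: hom'_P4'[OF g(1) lf] Sh_def vertex_avg_def flip: n_def e_def)
  define c where "c = n\<^sup>2 / (2 * e)\<^sup>2"
  have c: "c \<noteq> 0" using n by (simp add: c_def)
  \<comment> \<open>Multiplying by \<open>n * S 1 / (2 * e) = 1\<close> gives the linear terms the
    same factor \<open>c\<close> as the square of \<open>assort_b\<close>.\<close>
  have E: "n * x / (2 * e) = c * (S 1 * x)" for x
  proof -
    have "c * (S 1 * x) = n * (n * S 1) * x / (2 * e)\<^sup>2" by (simp add: c_def power2_eq_square)
    then show ?thesis unfolding S1 using n by (simp add: power2_eq_square)
  qed
  have num: "assort_g g - (assort_b g)\<^sup>2 = c * (S 1 * Sh - (S 2)\<^sup>2)"
    unfolding gg E[of Sh] b by (simp add: c_def power_divide power_mult_distrib algebra_simps diff_divide_distrib)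
  have den: "assort_b' g - (assort_b g)\<^sup>2 = c * (S 1 * S 3 - (S 2)\<^sup>2)"
    unfolding b' E[of "S 3"] b by (simp add: c_def power_divide power_mult_distrib algebra_simps diff_divide_distrib)
  show ?thesis
    unfolding assortativity_def num den Sh_def[symmetric] using c False by simp
qed

section \<open>Removing the truncation\<close>

lemma trunc_degree_power_tendsto:
  "(\<lambda>K. trunc_degree_power K k g v) \<longlonglongrightarrow> real (vertex_degree g v) ^ k"
proof (rule tendsto_eventually)
  show "\<forall>\<^sub>F K in sequentially. trunc_degree_power K k g v = real (vertex_degree g v) ^ k"
    using eventually_ge_at_top[of "vertex_degree g v"]
    by eventually_elim (simp add: trunc_degree_power_def)
qed

lemma trunc_hom_tendsto:
  assumes "simple_graph g" "locally_finite g" "v \<in> verts g"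
  shows "(\<lambda>K. trunc_hom K g v) \<longlonglongrightarrow> real (hom' P4' g v)"
  unfolding trunc_hom_def hom'_P4'[OF assms] of_nat_sum of_nat_mult
  using trunc_degree_power_tendsto[of 1] by (intro tendsto_sum tendsto_mult) auto

lemma trunc_hom_mono: "mono (\<lambda>K. trunc_hom K g v)"
  unfolding trunc_hom_def
  by (intro monoI sum_mono mult_mono) (auto simp: trunc_degree_power_def)

lemma truncated_moment_tendsto:
  fixes X :: "'s \<Rightarrow> nat"
  assumes X: "(\<lambda>\<omega>. real (X \<omega>)) \<in> borel_measurable N" and int: "integrable N (\<lambda>\<omega>. real (X \<omega>) ^ p)"
    and k: "0 < k" "k \<le> p"
  shows "(\<lambda>K. integral\<^sup>L N (\<lambda>\<omega>. if X \<omega> \<le> K then real (X \<omega>) ^ k else 0)) \<longlonglongrightarrow>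
    integral\<^sup>L N (\<lambda>\<omega>. real (X \<omega>) ^ k)"
proof (rule integral_dominated_convergence[where w = "\<lambda>\<omega>. real (X \<omega>) ^ p"])
  show "integrable N (\<lambda>\<omega>. real (X \<omega>) ^ p)" by fact
  show "(\<lambda>\<omega>. real (X \<omega>) ^ k) \<in> borel_measurable N" using X by measurable
  show "(\<lambda>\<omega>. if X \<omega> \<le> K then real (X \<omega>) ^ k else 0) \<in> borel_measurable N" for K
  proof -
    \<comment> \<open>The comparison is moved to the reals because measurability is given for the
      real-valued version of \<open>X\<close>.\<close>
    have "(\<lambda>\<omega>. if real (X \<omega>) \<le> real K then real (X \<omega>) ^ k else 0) \<in> borel_measurable N"
      using X by measurable
    then show ?thesis by simp
  qed
  show "AE \<omega> in N. (\<lambda>K. if X \<omega> \<le> K then real (X \<omega>) ^ k else 0) \<longlonglongrightarrow> real (X \<omega>) ^ k"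
  proof (intro AE_I2 tendsto_eventually)
    fix \<omega>
    show "\<forall>\<^sub>F K in sequentially. (if X \<omega> \<le> K then real (X \<omega>) ^ k else 0) = real (X \<omega>) ^ k"
      using eventually_ge_at_top[of "X \<omega>"] by eventually_elim simp
  qed
  \<comment> \<open>For \<open>n = 0\<close> this rests on \<open>0 < k\<close>, since
    \<open>0 ^ 0 = 1\<close>.\<close>
  have "real n ^ k \<le> real n ^ p" for n
    using k by (cases n) (auto intro!: power_increasing simp: power_0_left)
  then show "AE \<omega> in N. norm (if X \<omega> \<le> K then real (X \<omega>) ^ k else 0) \<le> real (X \<omega>) ^ p" for K
    by auto
qed

lemma vertex_avg_mono: "(\<And>v. v \<in> verts g \<Longrightarrow> F v \<le> F' v) \<Longrightarrow> vertex_avg g F \<le> vertex_avg g F'"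
  by (auto simp: vertex_avg_def intro!: divide_right_mono sum_mono)

lemma vertex_avg_diff: "vertex_avg g (\<lambda>v. F v - F' v) = vertex_avg g F - vertex_avg g F'"
  by (simp add: vertex_avg_def sum_subtractf diff_divide_distrib)

lemma vertex_degree_le_card:
  assumes "simple_graph g" "finite (verts g)"
  shows "vertex_degree g v \<le> card (verts g)"
  unfolding card_neighbours[symmetric] by (rule card_mono[OF assms(2) neighbours_verts[OF assms(1)]])

text \<open>A vertex loses either nothing or its whole power of the degree, and for natural numbers
  the \<open>k\<close>-th power is at most the \<open>p\<close>-th. Hence the loss in the cubes
  dominates that in the lower moments.\<close>

lemma abs_vertex_avg_degree_power_diff_trunc_le:
  assumes k: "0 < k" "k \<le> p"
  shows "\<bar>vertex_avg g (\<lambda>v. real (vertex_degree g v) ^ k) - vertex_avg g (trunc_degree_power K k g)\<bar> \<le>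
    vertex_avg g (\<lambda>v. real (vertex_degree g v) ^ p) - vertex_avg g (trunc_degree_power K p g)"
proof -
  have le: "real n ^ k \<le> real n ^ p" for n
    using k by (cases n) (auto intro!: power_increasing simp: power_0_left)
  have "vertex_avg g (\<lambda>v. real (vertex_degree g v) ^ k - trunc_degree_power K k g v) \<ge> 0"
    unfolding vertex_avg_def by (intro divide_nonneg_nonneg sum_nonneg) (auto simp: trunc_degree_power_def)
  moreover have "vertex_avg g (\<lambda>v. real (vertex_degree g v) ^ k - trunc_degree_power K k g v) \<le>
      vertex_avg g (\<lambda>v. real (vertex_degree g v) ^ p - trunc_degree_power K p g v)"
    using le by (intro vertex_avg_mono) (auto simp: trunc_degree_power_def)
  ultimately show ?thesis by (simp add: vertex_avg_diff)
qed

lemma abs_vertex_avg_hom_diff_trunc_le: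
  assumes g: "simple_graph g" "finite (verts g)"
  shows "\<bar>vertex_avg g (\<lambda>v. real (hom' P4' g v)) - vertex_avg g (trunc_hom K g)\<bar> \<le>
    2 * (vertex_avg g (\<lambda>v. real (vertex_degree g v) ^ 3) - vertex_avg g (trunc_degree_power K 3 g))"
proof -
  have "vertex_avg g (\<lambda>v. real (hom' P4' g v) - trunc_hom K g v) \<ge> 0"
    unfolding vertex_avg_def
    using trunc_hom_le_hom'[OF g(1) locally_finite_if_finite[OF g]]
    by (intro divide_nonneg_nonneg sum_nonneg) auto
  moreover have "vertex_avg g (\<lambda>v. real (hom' P4' g v) - trunc_hom K g v) \<le>
      2 * vertex_avg g (\<lambda>v. real (vertex_degree g v) ^ 3 - trunc_degree_power K 3 g v)"
    unfolding vertex_avg_def times_divide_eq_right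
    by (intro divide_right_mono sum_hom_diff_trunc_le[OF g]) simp
  ultimately show ?thesis by (simp add: vertex_avg_diff)
qed

section \<open>Isomorphism classes of balls\<close>

definition finite_rgraphs :: "nat rgraph set" where
  "finite_rgraphs = {R. connected_rgraph R \<and> finite (verts (graph_of R))}"

text \<open>Besides numbering the balls, this allows conditioning on the random graph by a countable
  sum over its values.\<close>

lemma countable_finite_graphs: "countable (finite_graphs m)"
proof (rule countable_subset)
  show "finite_graphs m \<subseteq> case_prod Graph ` ({V. finite V} \<times> {E. finite E \<and> E \<subseteq> {e. finite e}})"
  proof
    fix g assume g: "g \<in> finite_graphs m"
    have sub: "edges g \<subseteq> Pow (verts g)" using g by (auto simp: finite_graphs_def simple_graph_def)
    have fin: "finite (verts g)" using g by (simp add: finite_graphs_def)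
    have "finite (edges g)" "edges g \<subseteq> {e. finite e}"
      using finite_subset[OF sub] fin sub finite_subset[OF _ fin] by auto
    then show "g \<in> case_prod Graph ` ({V. finite V} \<times> {E. finite E \<and> E \<subseteq> {e. finite e}})"
      using fin by (intro image_eqI[of _ _ "(verts g, edges g)"]) auto
  qed
  show "countable (case_prod Graph ` ({V :: nat set. finite V} \<times> {E. finite E \<and> E \<subseteq> {e. finite e}}))"
    by (intro countable_image countable_SIGMA countable_Collect_finite
        countable_Collect_finite_subset)
qed

lemma countable_finite_rgraphs: "countable finite_rgraphs"
proof (rule countable_subset)
  show "finite_rgraphs \<subseteq> case_prod Rooted ` ((\<Union>m. finite_graphs m) \<times> UNIV)"
  proof
    fix R assume "R \<in> finite_rgraphs"
    then show "R \<in> case_prod Rooted ` ((\<Union>m. finite_graphs m) \<times> UNIV)"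
      by (intro image_eqI[of _ _ "(graph_of R, root R)"])
        (auto simp: finite_rgraphs_def connected_rgraph_def rooted_graph_def finite_graphs_def)
  qed
  show "countable (case_prod Rooted ` ((\<Union>m. finite_graphs m) \<times> UNIV))"
    using countable_finite_graphs by (intro countable_image countable_SIGMA) auto
qed

text \<open>The choice of a representative sees \<open>R\<close> only through the predicate
  \<open>R \<cong>\<^sub>* S\<close>, which is the same for isomorphic graphs. The type of a ball
  thus becomes a variable with values in the natural numbers, to which discrete probability
  applies.\<close>

definition iso_code :: "nat rgraph \<Rightarrow> nat" where
  "iso_code R = to_nat_on finite_rgraphs (SOME S. S \<in> finite_rgraphs \<and> R \<cong>\<^sub>* S)"

lemma iso_code_eq_iff:
  assumes "R \<in> finite_rgraphs" "S \<in> finite_rgraphs"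
  shows "iso_code R = iso_code S \<longleftrightarrow> R \<cong>\<^sub>* S"
proof -
  define rep where "rep R = (SOME S. S \<in> finite_rgraphs \<and> R \<cong>\<^sub>* S)" for R :: "nat rgraph"
  have sym: "R \<cong>\<^sub>* S \<Longrightarrow> S \<cong>\<^sub>* R" if "R \<in> finite_rgraphs" for R S :: "nat rgraph"
    using that rooted_iso_sym root_verts by (fastforce simp: finite_rgraphs_def)
  have rep: "rep R \<in> finite_rgraphs \<and> R \<cong>\<^sub>* rep R" if "R \<in> finite_rgraphs" for R
    unfolding rep_def by (rule someI[of _ R]) (use that rooted_iso_refl in auto)
  have "iso_code R = iso_code S \<longleftrightarrow> rep R = rep S"
    using rep assms countable_finite_rgraphs by (simp add: iso_code_def flip: rep_def)
  also have "\<dots> \<longleftrightarrow> R \<cong>\<^sub>* S"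
  proof
    assume "rep R = rep S"
    then show "R \<cong>\<^sub>* S" using rep sym assms rooted_iso_trans by metis
  next
    assume "R \<cong>\<^sub>* S"
    then have "R \<cong>\<^sub>* T \<longleftrightarrow> S \<cong>\<^sub>* T" for T :: "nat rgraph"
      using sym assms rooted_iso_trans by metis
    then show "rep R = rep S" by (simp add: rep_def)
  qed
  finally show ?thesis .
qed

section \<open>Balls as finite connected rooted graphs, and balls of the limit\<close>

lemma adj_relpow_sym: "(u, v) \<in> adj g ^^ k \<Longrightarrow> (v, u) \<in> adj g ^^ k"
proof (induction k arbitrary: v)
  case (Suc k)
  then obtain w where "(u, w) \<in> adj g ^^ k" "(v, w) \<in> adj g"
    by (auto simp: adj_def insert_commute)
  moreover from this have "(v, u) \<in> adj g O adj g ^^ k" using Suc.IH by blast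
  ultimately show ?case by (simp only: relpow_commute relpow.simps)
qed simp

text \<open>A walk of length at most \<open>r\<close> from \<open>v\<close> stays inside the ball,
  so any two vertices are joined through \<open>v\<close>. Connectedness is what allows a ball to be
  used as the test graph \<open>H\<close> in local convergence.\<close>

lemma connected_nbhd:
  assumes "simple_graph g" "v \<in> verts g"
  shows "connected_rgraph (nbhd r g v)"
  unfolding connected_rgraph_def
proof (intro conjI ballI)
  let ?h = "graph_of (nbhd r g v)"
  show "rooted_graph (nbhd r g v)" by (rule rooted_graph_nbhd[OF assms])
  have walk: "\<exists>k. (v, u) \<in> adj ?h ^^ k" if "u \<in> verts ?h" for u
    using that relpow_nbhd[OF assms] unfolding verts_nbhd by blast
  fix u w assume "u \<in> verts ?h" "w \<in> verts ?h"
  then obtain j k where "(u, v) \<in> adj ?h ^^ j" "(v, w) \<in> adj ?h ^^ k"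
    using walk adj_relpow_sym by meson
  then have "(u, w) \<in> adj ?h ^^ (j + k)" by (auto simp: relpow_add)
  then have "gdist ?h u w \<le> enat (j + k)" unfolding gdist_le_iff by blast
  then show "gdist ?h u w < \<infinity>" by (rule le_less_trans) simp
qed

text \<open>The ball of an arbitrary representative: only its isomorphism class is determined by
  \<open>x\<close>.\<close>

definition star_ball :: "nat \<Rightarrow> gstar \<Rightarrow> nat rgraph" where
  "star_ball r x = nbhd r (graph_of (rep_gstar x)) (root (rep_gstar x))"

lemma rep_gstar:
  "connected_rgraph (rep_gstar x)" "locally_finite (graph_of (rep_gstar x))"
  "simple_graph (graph_of (rep_gstar x))" "root (rep_gstar x) \<in> verts (graph_of (rep_gstar x))"
  using Quotient3_rep_reflp[OF Quotient3_gstar, of x]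
  by (auto simp: gstar_rel_def connected_rgraph_def rooted_graph_def)

lemma nbhd_in_finite_rgraphs:
  "simple_graph g \<Longrightarrow> v \<in> verts g \<Longrightarrow> locally_finite g \<Longrightarrow> nbhd r g v \<in> finite_rgraphs"
  unfolding finite_rgraphs_def by (intro CollectI conjI connected_nbhd finite_nbhd)

lemma star_ball_in_finite_rgraphs: "star_ball r x \<in> finite_rgraphs"
  unfolding star_ball_def by (intro nbhd_in_finite_rgraphs rep_gstar)

lemma ball_iso_iff: "ball_iso r x H \<longleftrightarrow> star_ball r x \<cong>\<^sub>* H"
  by (simp add: ball_iso.rep_eq star_ball_def)

text \<open>Points at distance less than \<open>1 / 2 ^ r\<close> have isomorphic balls of radius
  \<open>r\<close>.\<close>

lemma open_ball_iso: "open {x. ball_iso r x H}"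
  unfolding open_dist
proof (intro ballI exI[of _ "1 / 2 ^ r"] conjI allI impI)
  fix x y assume x: "x \<in> {x. ball_iso r x H}" and "dist y x < 1 / 2 ^ r"
  then have "balls_agree r y x"
    using dloc_le_iff by (metis dist_gstar_def less_imp_le)
  then have "star_ball r y \<cong>\<^sub>* star_ball r x" by (simp add: balls_agree.rep_eq star_ball_def)
  then show "y \<in> {x. ball_iso r x H}"
    using x rooted_iso_trans by (auto simp: ball_iso_iff)
qed simp

text \<open>The code is even continuous into the discrete space: the preimage of any set of codes is
  a union of the open sets on which the ball has a given type.\<close>

lemma iso_code_measurable:
  assumes "Gs \<in> borel_measurable N"
  shows "(\<lambda>\<omega>. iso_code (star_ball r (Gs \<omega>))) \<in> measurable N (count_space UNIV)"
proof (rule measurable_compose[OF assms], rule measurableI)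
  fix A :: "nat set"
  let ?S = "{H \<in> finite_rgraphs. iso_code H \<in> A}"
  have "(\<lambda>x. iso_code (star_ball r x)) -` A = (\<Union>H\<in>?S. {x. ball_iso r x H})"
  proof (intro equalityI subsetI)
    fix x assume "x \<in> (\<lambda>x. iso_code (star_ball r x)) -` A"
    then show "x \<in> (\<Union>H\<in>?S. {x. ball_iso r x H})"
      using star_ball_in_finite_rgraphs rooted_iso_refl
      by (intro UN_I[of "star_ball r x"]) (auto simp: ball_iso_iff)
  next
    fix x assume "x \<in> (\<Union>H\<in>?S. {x. ball_iso r x H})"
    then show "x \<in> (\<lambda>x. iso_code (star_ball r x)) -` A"
      using star_ball_in_finite_rgraphs iso_code_eq_iff by (fastforce simp: ball_iso_iff)
  qed
  then have "open ((\<lambda>x. iso_code (star_ball r x)) -` A)"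
    by (simp only:) (intro open_UN ballI open_ball_iso)
  then show "(\<lambda>x. iso_code (star_ball r x)) -` A \<inter> space borel \<in> sets borel" by simp
qed simp

section \<open>Averages over a uniformly random vertex\<close>

lemma finite_graphsD:
  "g \<in> finite_graphs m \<Longrightarrow> simple_graph g" "g \<in> finite_graphs m \<Longrightarrow> finite (verts g)"
  "g \<in> finite_graphs m \<Longrightarrow> locally_finite g" "g \<in> finite_graphs m \<Longrightarrow> m > 0 \<Longrightarrow> verts g \<noteq> {}"
  by (auto simp: finite_graphs_def intro: locally_finite_if_finite)

lemma vertex_avg_eq_expectation:
  assumes "finite (verts g)" "verts g \<noteq> {}"
  shows "vertex_avg g F = measure_pmf.expectation (pmf_of_set (verts g)) F"
  using assms by (simp add: vertex_avg_def integral_pmf_of_set)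

lemma vertex_avg_cong: "(\<And>v. v \<in> verts g \<Longrightarrow> F v = F' v) \<Longrightarrow> vertex_avg g F = vertex_avg g F'"
  by (simp add: vertex_avg_def)

text \<open>This is the tower property, for a vertex whose conditional law is prescribed only on the
  events \<open>G = g\<close> of positive probability. Splitting over the countably many graphs
  freezes \<open>g\<close>, and then \<open>F g\<close> is integrated against the uniform
  distribution. Nonnegative integrals allow all exchanges before integrability is known.\<close>

lemma expectation_uniform_vertex:
  fixes F :: "nat graph \<Rightarrow> nat \<Rightarrow> real"
  assumes "prob_space M" and G: "G \<in> measurable M (count_space (finite_graphs m))" and m: "m > 0"
    and unif: "uniform_vertex M G v" and F: "\<And>g x. F g x \<ge> 0"
  shows "integral\<^sup>L M (\<lambda>\<omega>. F (G \<omega>) (v \<omega>)) = integral\<^sup>L M (\<lambda>\<omega>. vertex_avg (G \<omega>) (F (G \<omega>)))"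
proof -
  interpret prob_space M by fact
  let ?A = "finite_graphs m"
  have v [measurable]: "v \<in> measurable M (count_space UNIV)"
    using unif by (simp add: uniform_vertex_def)
  have GA: "G \<omega> \<in> ?A" if "\<omega> \<in> space M" for \<omega> using measurable_space[OF G that] by simp
  have Gg: "{\<omega> \<in> space M. G \<omega> = g} \<in> sets M" if "g \<in> ?A" for g
  proof -
    have "G -` {g} \<inter> space M \<in> sets M" using that by (intro measurable_sets[OF G]) auto
    also have "G -` {g} \<inter> space M = {\<omega> \<in> space M. G \<omega> = g}" by auto
    finally show ?thesis .
  qed
  have joint: "emeasure M {\<omega> \<in> space M. G \<omega> = g \<and> v \<omega> = x} =
      emeasure M {\<omega> \<in> space M. G \<omega> = g} * ennreal (pmf (pmf_of_set (verts g)) x)" if g: "g \<in> ?A" for g x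
  proof -
    have "prob {\<omega> \<in> space M. v \<omega> = x \<and> G \<omega> = g} =
      prob {\<omega> \<in> space M. G \<omega> = g} * pmf (pmf_of_set (verts g)) x"
    \<comment> \<open>On a null event \<open>uniform_vertex\<close> says nothing, but there both
      sides are 0.\<close>
    proof (cases "prob {\<omega> \<in> space M. G \<omega> = g} = 0")
      case True
      have "prob {\<omega> \<in> space M. v \<omega> = x \<and> G \<omega> = g} \<le> prob {\<omega> \<in> space M. G \<omega> = g}"
        using Gg[OF g] by (intro finite_measure_mono) auto
      then show ?thesis using True by (simp add: measure_le_0_iff)
    next
      case False
      then have "prob {\<omega> \<in> space M. v \<omega> = x \<and> G \<omega> = g} / prob {\<omega> \<in> space M. G \<omega> = g} = pmf (pmf_of_set (verts g)) x"
        using unif by (simp add: uniform_vertex_def cond_prob_def)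
      then show ?thesis using False by (simp add: field_simps)
    qed
    then show ?thesis
      by (simp add: emeasure_eq_measure ennreal_mult conj_commute)
  qed
  have ind: "(\<integral>\<^sup>+ p. f p * indicator {p} q \<partial>count_space B) = f q"
    if "q \<in> B" for q :: 'q and f :: "'q \<Rightarrow> ennreal" and B
  proof -
    have "(\<integral>\<^sup>+ p. f p * indicator {p} q \<partial>count_space B) = (\<integral>\<^sup>+ p. f q * indicator {q} p \<partial>count_space B)"
      by (intro nn_integral_cong) (auto simp: indicator_def)
    also have "\<dots> = f q" using that by (subst nn_integral_cmult_indicator) auto
    finally show ?thesis .
  qed
  have cond: "(\<integral>\<^sup>+ \<omega>. ennreal (F g (v \<omega>)) * indicator {g} (G \<omega>) \<partial>M) =
      (\<integral>\<^sup>+ \<omega>. ennreal (vertex_avg g (F g)) * indicator {g} (G \<omega>) \<partial>M)" if g: "g \<in> ?A" for g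
  proof -
    have fin: "finite (verts g)" "verts g \<noteq> {}" using finite_graphsD[OF g] m by auto
    let ?E = "\<lambda>x. {\<omega> \<in> space M. G \<omega> = g \<and> v \<omega> = x}"
    have E: "?E x \<in> sets M" for x
    proof -
      have "?E x = {\<omega> \<in> space M. G \<omega> = g} \<inter> {\<omega> \<in> space M. v \<omega> = x}" by auto
      also have "\<dots> \<in> sets M" using Gg[OF g] by (intro sets.Int) auto
      finally show ?thesis .
    qed
    have "(\<integral>\<^sup>+ \<omega>. ennreal (F g (v \<omega>)) * indicator {g} (G \<omega>) \<partial>M) =
        (\<integral>\<^sup>+ \<omega>. (\<integral>\<^sup>+ x. ennreal (F g x) * indicator (?E x) \<omega> \<partial>count_space UNIV) \<partial>M)"
    proof (rule nn_integral_cong)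
      fix \<omega> assume \<omega>: "\<omega> \<in> space M"
      have "(\<integral>\<^sup>+ x. ennreal (F g x) * indicator (?E x) \<omega> \<partial>count_space UNIV) =
          (\<integral>\<^sup>+ x. ennreal (F g x) * indicator {g} (G \<omega>) * indicator {x} (v \<omega>) \<partial>count_space UNIV)"
        using \<omega> by (intro nn_integral_cong) (auto simp: indicator_def)
      also have "\<dots> = ennreal (F g (v \<omega>)) * indicator {g} (G \<omega>)"
        by (rule ind) simp
      finally show "ennreal (F g (v \<omega>)) * indicator {g} (G \<omega>) =
          (\<integral>\<^sup>+ x. ennreal (F g x) * indicator (?E x) \<omega> \<partial>count_space UNIV)" by simp
    qed
    also have "\<dots> = (\<integral>\<^sup>+ x. (\<integral>\<^sup>+ \<omega>. ennreal (F g x) * indicator (?E x) \<omega> \<partial>M) \<partial>count_space UNIV)"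
      using E by (intro nn_integral_count_space_nn_integral) auto
    also have "\<dots> = (\<integral>\<^sup>+ x. ennreal (F g x) * (emeasure M {\<omega> \<in> space M. G \<omega> = g} * ennreal (pmf (pmf_of_set (verts g)) x)) \<partial>count_space UNIV)"
      using E joint[OF g] by (intro nn_integral_cong) (simp add: nn_integral_cmult_indicator)
    also have "\<dots> = (\<integral>\<^sup>+ x. emeasure M {\<omega> \<in> space M. G \<omega> = g} * (ennreal (pmf (pmf_of_set (verts g)) x) * ennreal (F g x)) \<partial>count_space UNIV)"
      by (intro nn_integral_cong) (simp add: mult_ac)
    also have "\<dots> = emeasure M {\<omega> \<in> space M. G \<omega> = g} * (\<integral>\<^sup>+ x. ennreal (F g x) \<partial>measure_pmf (pmf_of_set (verts g)))"
      by (simp add: nn_integral_cmult nn_integral_measure_pmf)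
    also have "(\<integral>\<^sup>+ x. ennreal (F g x) \<partial>measure_pmf (pmf_of_set (verts g))) = ennreal (vertex_avg g (F g))"
      unfolding vertex_avg_eq_expectation[OF fin]
      using F fin by (intro nn_integral_eq_integral integrable_measure_pmf_finite) auto
    also have "emeasure M {\<omega> \<in> space M. G \<omega> = g} * ennreal (vertex_avg g (F g)) =
        (\<integral>\<^sup>+ \<omega>. ennreal (vertex_avg g (F g)) * indicator {\<omega> \<in> space M. G \<omega> = g} \<omega> \<partial>M)"
      using Gg[OF g] by (simp add: nn_integral_cmult_indicator mult.commute)
    also have "\<dots> = (\<integral>\<^sup>+ \<omega>. ennreal (vertex_avg g (F g)) * indicator {g} (G \<omega>) \<partial>M)"
      by (intro nn_integral_cong) (auto simp: indicator_def)
    finally show ?thesis .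
  qed
  have meas: "(\<lambda>\<omega>. ennreal (f \<omega>) * indicator {g} (G \<omega>)) \<in> borel_measurable M"
    if "f \<in> borel_measurable M" "g \<in> ?A" for f and g
  proof -
    have [measurable]: "f \<in> borel_measurable M" "{\<omega> \<in> space M. G \<omega> = g} \<in> sets M" using that Gg by auto
    have "(\<lambda>\<omega>. ennreal (f \<omega>) * indicator {\<omega> \<in> space M. G \<omega> = g} \<omega>) \<in> borel_measurable M" by measurable
    also have "?this \<longleftrightarrow> ?thesis" by (intro measurable_cong) (auto simp: indicator_def)
    finally show ?thesis .
  qed
  \<comment> \<open>The first argument of \<open>f\<close> is the graph to be frozen. Using this
    both for \<open>F g (v \<omega>)\<close> and for the average, constant in
    \<open>\<omega>\<close>, reduces the claim to \<open>cond\<close> for each graph.\<close>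
  have decomp: "(\<integral>\<^sup>+ \<omega>. ennreal (f (G \<omega>) \<omega>) \<partial>M) =
      (\<integral>\<^sup>+ g. (\<integral>\<^sup>+ \<omega>. ennreal (f g \<omega>) * indicator {g} (G \<omega>) \<partial>M) \<partial>count_space ?A)"
    if "\<And>g. f g \<in> borel_measurable M" for f
  proof -
    have "(\<integral>\<^sup>+ \<omega>. ennreal (f (G \<omega>) \<omega>) \<partial>M) =
      (\<integral>\<^sup>+ \<omega>. (\<integral>\<^sup>+ g. ennreal (f g \<omega>) * indicator {g} (G \<omega>) \<partial>count_space ?A) \<partial>M)"
      using ind[OF GA] by (intro nn_integral_cong) simp
    also have "\<dots> = (\<integral>\<^sup>+ g. (\<integral>\<^sup>+ \<omega>. ennreal (f g \<omega>) * indicator {g} (G \<omega>) \<partial>M) \<partial>count_space ?A)"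
      using that by (intro nn_integral_count_space_nn_integral countable_finite_graphs meas) auto
    finally show ?thesis .
  qed
  have Fv: "(\<lambda>\<omega>. F g (v \<omega>)) \<in> borel_measurable M" for g by measurable
  have nn: "(\<integral>\<^sup>+ \<omega>. ennreal (F (G \<omega>) (v \<omega>)) \<partial>M) = (\<integral>\<^sup>+ \<omega>. ennreal (vertex_avg (G \<omega>) (F (G \<omega>))) \<partial>M)"
    using decomp[of "\<lambda>g \<omega>. F g (v \<omega>)"] decomp[of "\<lambda>g \<omega>. vertex_avg g (F g)"] Fv cond
    by (simp cong: nn_integral_cong_simp)
  have avg_meas: "(\<lambda>\<omega>. vertex_avg (G \<omega>) (F (G \<omega>))) \<in> borel_measurable M"
    by (rule measurable_compose[OF G]) simp
  have F_meas: "(\<lambda>\<omega>. F (G \<omega>) (v \<omega>)) \<in> borel_measurable M"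
    by (rule measurable_compose_countable'[OF Fv G countable_finite_graphs])
  show ?thesis
    using nn avg_meas F_meas F
    by (simp add: integral_eq_nn_integral vertex_avg_def sum_nonneg)
qed

section \<open>Local functionals of random graphs\<close>

text \<open>An invariant functional factors through the code, by evaluation at any ball with that
  code. Measurability and approximation then only concern functions of a natural number.\<close>

lemma isomorphism_invariant_code:
  assumes inv: "\<And>R S. R \<in> finite_rgraphs \<Longrightarrow> S \<in> finite_rgraphs \<Longrightarrow> R \<cong>\<^sub>* S \<Longrightarrow> \<Phi> R = \<Phi> S"
    and R: "R \<in> finite_rgraphs"
  shows "\<Phi> R = \<Phi> (inv_into finite_rgraphs iso_code (iso_code R))"
proof (rule inv[OF R])
  let ?S = "inv_into finite_rgraphs iso_code (iso_code R)"
  show S: "?S \<in> finite_rgraphs" using R by (intro inv_into_into) simp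
  have "iso_code R = iso_code ?S" using R by (simp add: f_inv_into_f)
  then show "R \<cong>\<^sub>* ?S" using iso_code_eq_iff[OF R S] by blast
qed

lemma isomorphism_invariant_measurable:
  fixes \<Phi> :: "nat rgraph \<Rightarrow> real"
  assumes Gs: "Gs \<in> borel_measurable N"
    and inv: "\<And>R S. R \<in> finite_rgraphs \<Longrightarrow> S \<in> finite_rgraphs \<Longrightarrow> R \<cong>\<^sub>* S \<Longrightarrow> \<Phi> R = \<Phi> S"
  shows "(\<lambda>\<omega>. \<Phi> (star_ball r (Gs \<omega>))) \<in> borel_measurable N"
proof -
  have "(\<lambda>\<omega>. \<Phi> (star_ball r (Gs \<omega>))) =
    (\<lambda>\<omega>. \<Phi> (inv_into finite_rgraphs iso_code (iso_code (star_ball r (Gs \<omega>)))))"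
    using isomorphism_invariant_code[of \<Phi>, OF inv star_ball_in_finite_rgraphs] by blast
  also have "\<dots> \<in> borel_measurable N"
    by (rule measurable_compose[OF iso_code_measurable[OF Gs]]) simp
  finally show ?thesis .
qed

lemma vertex_degree_root_iso:
  assumes "R \<in> finite_rgraphs" "S \<in> finite_rgraphs" "R \<cong>\<^sub>* S"
  shows "vertex_degree (graph_of R) (root R) = vertex_degree (graph_of S) (root S)"
proof -
  obtain f where f: "is_rooted_iso f R S" using assms(3) by (auto simp: rooted_iso_def)
  then have "f (root R) = root S" by (simp add: is_rooted_iso_def)
  then show ?thesis
    using assms(1,2) vertex_degree_iso[OF _ _ f, of "root R"]
    by (simp add: finite_rgraphs_def connected_rgraph_def rooted_graph_def)
qed

text \<open>These assumptions suffice for bounded local functionals; moments enter only in the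
  theorem. Nonempty vertex sets make \<open>pmf_of_set\<close> the uniform distribution.\<close>

locale random_graphs_local_limit =
  fixes M :: "nat \<Rightarrow> 'w measure" and G :: "nat \<Rightarrow> 'w \<Rightarrow> nat graph" and m :: "nat \<Rightarrow> nat"
    and N :: "'s measure" and Gs :: "'s \<Rightarrow> gstar"
  assumes prob_M: "\<And>n. prob_space (M n)"
    and random_graph: "\<And>n. G n \<in> measurable (M n) (count_space (finite_graphs (m n)))"
    and m_pos: "\<And>n. m n > 0"
    and prob_N: "prob_space N"
    and random_limit: "Gs \<in> borel_measurable N"
    and local_limit: "local_conv_in_prob M G N Gs"
begin

lemma random_graph_in: "\<omega> \<in> space (M n) \<Longrightarrow> G n \<omega> \<in> finite_graphs (m n)"
  using measurable_space[OF random_graph] by simp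

lemma graph_functional_measurable: "(\<lambda>\<omega>. F (G n \<omega>) :: real) \<in> borel_measurable (M n)"
  by (rule measurable_compose[OF random_graph]) simp

text \<open>The frequency \<open>p_ball\<close> is rewritten as a probability under the uniform
  distribution on the vertices, so that each fixed graph is itself a probability space with a
  natural-number-valued ball type.\<close>

lemma conv_in_prob_iso_code:
  "conv_in_prob M (\<lambda>n \<omega>. measure_pmf.prob (pmf_of_set (verts (G n \<omega>))) {v. iso_code (nbhd r (G n \<omega>) v) = i})
    (\<P>(\<omega> in N. iso_code (star_ball r (Gs \<omega>)) = i))"
proof -
  have nb: "nbhd r (G n \<omega>) v \<in> finite_rgraphs" if "\<omega> \<in> space (M n)" "v \<in> verts (G n \<omega>)" for n \<omega> v
    using finite_graphsD[OF random_graph_in[OF that(1)]] that(2) by (intro nbhd_in_finite_rgraphs)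
  have pr: "measure_pmf.prob (pmf_of_set (verts (G n \<omega>))) {v. P v} =
      real (card {v \<in> verts (G n \<omega>). P v}) / real (card (verts (G n \<omega>)))"
    if "\<omega> \<in> space (M n)" for n \<omega> P
    using finite_graphsD[OF random_graph_in[OF that]] m_pos[of n]
    by (simp add: measure_pmf_of_set Int_def)
  show ?thesis
  proof (cases "i \<in> iso_code ` finite_rgraphs")
    case True
    then obtain H where H: "H \<in> finite_rgraphs" "i = iso_code H" by blast
    have "conv_in_prob M (\<lambda>n \<omega>. p_ball r (G n \<omega>) H) (\<P>(\<omega> in N. ball_iso r (Gs \<omega>) H))"
      using local_limit H(1) by (simp add: local_conv_in_prob_def finite_rgraphs_def)
    also have "\<P>(\<omega> in N. ball_iso r (Gs \<omega>) H) = \<P>(\<omega> in N. iso_code (star_ball r (Gs \<omega>)) = i)"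
      unfolding ball_iso_iff H(2) iso_code_eq_iff[OF star_ball_in_finite_rgraphs H(1)] ..
    finally have conv: "conv_in_prob M (\<lambda>n \<omega>. p_ball r (G n \<omega>) H)
        (\<P>(\<omega> in N. iso_code (star_ball r (Gs \<omega>)) = i))" .
    have "p_ball r (G n \<omega>) H = measure_pmf.prob (pmf_of_set (verts (G n \<omega>))) {v. iso_code (nbhd r (G n \<omega>) v) = i}"
      if \<omega>: "\<omega> \<in> space (M n)" for n \<omega>
    proof -
      have "{v \<in> verts (G n \<omega>). nbhd r (G n \<omega>) v \<cong>\<^sub>* H} =
          {v \<in> verts (G n \<omega>). iso_code (nbhd r (G n \<omega>) v) = i}"
        using iso_code_eq_iff[OF nb[OF \<omega>] H(1)] H(2) by blast
      then show ?thesis unfolding pr[OF \<omega>] p_ball_def by simp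
    qed
    then show ?thesis by (rule conv_in_prob_cong[OF conv])
  next
    \<comment> \<open>Not every number is the code of a ball; for the others both sides are
      0.\<close>
    case False
    have "\<P>(\<omega> in N. iso_code (star_ball r (Gs \<omega>)) = i) = 0"
      using False star_ball_in_finite_rgraphs by (metis (mono_tags, lifting) Collect_empty_eq imageI measure_empty)
    moreover have "0 = measure_pmf.prob (pmf_of_set (verts (G n \<omega>))) {v. iso_code (nbhd r (G n \<omega>) v) = i}"
      if \<omega>: "\<omega> \<in> space (M n)" for n \<omega>
    proof -
      have empty: "{v \<in> verts (G n \<omega>). iso_code (nbhd r (G n \<omega>) v) = i} = {}"
        using nb[OF \<omega>] False by blast
      show ?thesis unfolding pr[OF \<omega>] empty by simp
    qed
    then have "conv_in_prob M (\<lambda>n \<omega>. measure_pmf.prob (pmf_of_set (verts (G n \<omega>))) {v. iso_code (nbhd r (G n \<omega>) v) = i}) 0"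
      by (rule conv_in_prob_cong[OF conv_in_prob_const])
    ultimately show ?thesis by simp
  qed
qed

text \<open>Tightness of the ball types is not assumed but inherited: once the frequencies of
  finitely many types carrying almost all the mass of the limit have nearly converged, little is
  left for the other types in the finite graph.\<close>

lemma conv_in_prob_local_functional:
  assumes inv: "\<And>R S. R \<in> finite_rgraphs \<Longrightarrow> S \<in> finite_rgraphs \<Longrightarrow> R \<cong>\<^sub>* S \<Longrightarrow> \<Phi> R = \<Phi> S"
    and B: "\<And>R. \<bar>\<Phi> R\<bar> \<le> B"
  shows "conv_in_prob M (\<lambda>n \<omega>. vertex_avg (G n \<omega>) (\<lambda>v. \<Phi> (nbhd r (G n \<omega>) v)))
    (integral\<^sup>L N (\<lambda>\<omega>. \<Phi> (star_ball r (Gs \<omega>))))"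
proof (rule conv_in_prob_if_close[OF prob_M])
  fix \<epsilon> :: real assume \<epsilon>: "\<epsilon> > 0"
  interpret N: prob_space N by (rule prob_N)
  define \<psi> where "\<psi> i = \<Phi> (inv_into finite_rgraphs iso_code i)" for i
  have \<psi>: "\<Phi> R = \<psi> (iso_code R)" if "R \<in> finite_rgraphs" for R
    unfolding \<psi>_def using isomorphism_invariant_code[of \<Phi>, OF inv that] .
  have \<psi>B: "\<bar>\<psi> i\<bar> \<le> B" for i using B by (simp add: \<psi>_def)
  have B0: "B \<ge> 0" using \<psi>B[of 0] by simp
  define q where "q i = \<P>(\<omega> in N. iso_code (star_ball r (Gs \<omega>)) = i)" for i
  define e where "e i n \<omega> = measure_pmf.prob (pmf_of_set (verts (G n \<omega>))) {v. iso_code (nbhd r (G n \<omega>) v) = i}" for i n \<omega>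
  note code = iso_code_measurable[OF random_limit, of r]
  \<comment> \<open>The total error is at most \<open>4 * (B * \<eta>)\<close>: twice
    \<open>B * \<eta>\<close> for the tail in the finite graph, once for the tail in the limit, once
    for the first \<open>I\<close> types. The latter uses the tolerance
    \<open>\<eta> / (real I + 1)\<close> for each type. The added 1 in both denominators covers
    \<open>B = 0\<close> and \<open>I = 0\<close>.\<close>
  define \<eta> where "\<eta> = \<epsilon> / (4 * (B + 1))"
  have \<eta>: "\<eta> > 0" "4 * (B * \<eta>) \<le> \<epsilon>" using \<epsilon> B0 by (auto simp: \<eta>_def field_simps)
  have "q sums 1" unfolding q_def by (rule N.prob_nat_sums[OF code])
  then have "(\<lambda>I. \<Sum>i<I. q i) \<longlonglongrightarrow> 1" by (simp add: sums_def)
  then have "\<forall>\<^sub>F I in sequentially. 1 - \<eta> < (\<Sum>i<I. q i)"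
    using \<eta> by (intro order_tendstoD) auto
  then obtain I where I: "1 - \<eta> < (\<Sum>i<I. q i)" by (auto simp: eventually_sequentially)
  have "\<bar>vertex_avg (G n \<omega>) (\<lambda>v. \<Phi> (nbhd r (G n \<omega>) v)) - integral\<^sup>L N (\<lambda>\<omega>. \<Phi> (star_ball r (Gs \<omega>)))\<bar> \<le> \<epsilon>"
    if \<omega>: "\<omega> \<in> space (M n)" and close: "\<And>i. i < I \<Longrightarrow> \<bar>e i n \<omega> - q i\<bar> \<le> \<eta> / (real I + 1)" for n \<omega>
  proof -
    note g = finite_graphsD[OF random_graph_in[OF \<omega>]]
    let ?V = "pmf_of_set (verts (G n \<omega>))"
    have a: "vertex_avg (G n \<omega>) (\<lambda>v. \<Phi> (nbhd r (G n \<omega>) v)) =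
        measure_pmf.expectation ?V (\<lambda>v. \<psi> (iso_code (nbhd r (G n \<omega>) v)))"
      using \<psi> nbhd_in_finite_rgraphs g m_pos[of n]
      by (subst vertex_avg_eq_expectation[symmetric]) (auto intro: vertex_avg_cong)
    have b: "integral\<^sup>L N (\<lambda>\<omega>. \<Phi> (star_ball r (Gs \<omega>))) =
        N.expectation (\<lambda>\<omega>. \<psi> (iso_code (star_ball r (Gs \<omega>))))"
      using \<psi>[OF star_ball_in_finite_rgraphs] by simp
    have 1: "\<bar>measure_pmf.expectation ?V (\<lambda>v. \<psi> (iso_code (nbhd r (G n \<omega>) v))) - (\<Sum>i<I. \<psi> i * e i n \<omega>)\<bar>
        \<le> B * (1 - (\<Sum>i<I. e i n \<omega>))"
      using measure_pmf.expectation_truncated_sum[of "\<lambda>v. iso_code (nbhd r (G n \<omega>) v)" ?V \<psi> B I] \<psi>B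
      by (simp add: e_def)
    have 2: "\<bar>N.expectation (\<lambda>\<omega>. \<psi> (iso_code (star_ball r (Gs \<omega>)))) - (\<Sum>i<I. \<psi> i * q i)\<bar>
        \<le> B * (1 - (\<Sum>i<I. q i))"
      unfolding q_def by (rule N.expectation_truncated_sum[OF code \<psi>B])
    have I1: "real I * (\<eta> / (real I + 1)) \<le> \<eta>" using \<eta>(1) by (simp add: field_simps)
    have "\<bar>(\<Sum>i<I. \<psi> i * e i n \<omega>) - (\<Sum>i<I. \<psi> i * q i)\<bar> = \<bar>\<Sum>i<I. \<psi> i * (e i n \<omega> - q i)\<bar>"
      by (simp add: sum_subtractf right_diff_distrib)
    also have "\<dots> \<le> (\<Sum>i<I. \<bar>\<psi> i * (e i n \<omega> - q i)\<bar>)" by (rule sum_abs)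
    also have "\<dots> \<le> (\<Sum>i<I. B * (\<eta> / (real I + 1)))"
      unfolding abs_mult using \<psi>B close B0 by (intro sum_mono mult_mono) auto
    also have "\<dots> = B * (real I * (\<eta> / (real I + 1)))" by simp
    also have "\<dots> \<le> B * \<eta>" by (rule mult_left_mono[OF I1 B0])
    finally have 3: "\<bar>(\<Sum>i<I. \<psi> i * e i n \<omega>) - (\<Sum>i<I. \<psi> i * q i)\<bar> \<le> B * \<eta>" .
    have "(\<Sum>i<I. q i) - (\<Sum>i<I. e i n \<omega>) \<le> (\<Sum>i<I. \<eta> / (real I + 1))"
      unfolding sum_subtractf[symmetric] using close by (intro sum_mono) (fastforce simp: abs_le_iff)
    then have "1 - (\<Sum>i<I. e i n \<omega>) \<le> 2 * \<eta>" using I I1 by simp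
    then have 4: "B * (1 - (\<Sum>i<I. e i n \<omega>)) \<le> B * (2 * \<eta>)" using B0 by (rule mult_left_mono)
    have 5: "B * (1 - (\<Sum>i<I. q i)) \<le> B * \<eta>" using B0 I by (intro mult_left_mono) auto
    show ?thesis unfolding a b using 1 2 3 4 5 \<eta>(2) by linarith
  qed
  moreover have "conv_in_prob M (e i) (q i)" for i
    using conv_in_prob_iso_code[of r i] by (simp add: e_def[abs_def] q_def)
  moreover have "e i n \<in> borel_measurable (M n)" for i n
    unfolding e_def by (rule graph_functional_measurable)
  ultimately show "\<exists>F \<delta>. finite F \<and> \<delta> > 0 \<and>
      (\<forall>(X, c)\<in>F. (\<forall>n. X n \<in> borel_measurable (M n)) \<and> conv_in_prob M X c) \<and>
      (\<forall>n. \<forall>\<omega>\<in>space (M n). (\<forall>(X, c)\<in>F. \<bar>X n \<omega> - c\<bar> \<le> \<delta>) \<longrightarrow>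
        \<bar>vertex_avg (G n \<omega>) (\<lambda>v. \<Phi> (nbhd r (G n \<omega>) v)) - integral\<^sup>L N (\<lambda>\<omega>. \<Phi> (star_ball r (Gs \<omega>)))\<bar> \<le> \<epsilon>)"
    using \<eta>(1) by (intro exI[of _ "(\<lambda>i. (e i, q i)) ` {..<I}"] exI[of _ "\<eta> / (real I + 1)"]) auto
qed

section \<open>Limits of the truncated averages\<close>

lemma conv_in_prob_trunc_degree_power:
  "conv_in_prob M (\<lambda>n \<omega>. vertex_avg (G n \<omega>) (trunc_degree_power K k (G n \<omega>)))
    (integral\<^sup>L N (\<lambda>\<omega>. if root_degree (Gs \<omega>) \<le> K then real (root_degree (Gs \<omega>)) ^ k else 0))"
proof -
  define \<Phi> where "\<Phi> R = trunc_degree_power K k (graph_of R) (root R)" for R :: "nat rgraph"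
  have inv: "\<Phi> R = \<Phi> S" if "R \<in> finite_rgraphs" "S \<in> finite_rgraphs" "R \<cong>\<^sub>* S" for R S
    using vertex_degree_root_iso[OF that] by (simp add: \<Phi>_def trunc_degree_power_def)
  have nb: "\<Phi> (nbhd 2 g v) = trunc_degree_power K k g v" if "simple_graph g" "v \<in> verts g" for g v
    unfolding \<Phi>_def using trunc_degree_power_nbhd[OF that, of v 0 2] by simp
  have "conv_in_prob M (\<lambda>n \<omega>. vertex_avg (G n \<omega>) (\<lambda>v. \<Phi> (nbhd 2 (G n \<omega>) v)))
      (integral\<^sup>L N (\<lambda>\<omega>. \<Phi> (star_ball 2 (Gs \<omega>))))"
    by (intro conv_in_prob_local_functional[OF inv, where B = "real K ^ k"])
      (auto simp: \<Phi>_def abs_of_nonneg trunc_degree_power_nonneg trunc_degree_power_le)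
  also have "(\<lambda>\<omega>. \<Phi> (star_ball 2 (Gs \<omega>))) =
      (\<lambda>\<omega>. if root_degree (Gs \<omega>) \<le> K then real (root_degree (Gs \<omega>)) ^ k else 0)"
    using rep_gstar by (auto simp: star_ball_def nb trunc_degree_power_def root_degree.rep_eq)
  finally show ?thesis
    by (rule conv_in_prob_cong) (auto intro!: vertex_avg_cong nb dest!: random_graph_in finite_graphsD(1))
qed

text \<open>The limit is expressed by the representative chosen by \<open>rep_gstar\<close>, a
  choice with no measurability of its own. Measurability comes from invariance under isomorphism,
  through the ball of radius 2.\<close>

lemma conv_in_prob_trunc_hom:
  "conv_in_prob M (\<lambda>n \<omega>. vertex_avg (G n \<omega>) (trunc_hom K (G n \<omega>)))
    (integral\<^sup>L N (\<lambda>\<omega>. trunc_hom K (graph_of (rep_gstar (Gs \<omega>))) (root (rep_gstar (Gs \<omega>)))))"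
    and measurable_trunc_hom:
  "(\<lambda>\<omega>. trunc_hom K (graph_of (rep_gstar (Gs \<omega>))) (root (rep_gstar (Gs \<omega>)))) \<in> borel_measurable N"
proof -
  define \<Phi> where "\<Phi> R = trunc_hom K (graph_of R) (root R)" for R :: "nat rgraph"
  have inv: "\<Phi> R = \<Phi> S" if RS: "R \<in> finite_rgraphs" "S \<in> finite_rgraphs" "R \<cong>\<^sub>* S" for R S
  proof -
    obtain f where f: "is_rooted_iso f R S" using RS(3) by (auto simp: rooted_iso_def)
    then have "f (root R) = root S" by (simp add: is_rooted_iso_def)
    then show ?thesis
      using RS(1,2) trunc_hom_iso[OF _ _ f, of "root R" K]
      by (simp add: \<Phi>_def finite_rgraphs_def connected_rgraph_def rooted_graph_def)
  qed
  have nb: "\<Phi> (nbhd 2 g v) = trunc_hom K g v" if "simple_graph g" "v \<in> verts g" for g v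
    unfolding \<Phi>_def using trunc_hom_nbhd[OF that] by simp
  have eq: "(\<lambda>\<omega>. \<Phi> (star_ball 2 (Gs \<omega>))) =
      (\<lambda>\<omega>. trunc_hom K (graph_of (rep_gstar (Gs \<omega>))) (root (rep_gstar (Gs \<omega>))))"
    using rep_gstar by (simp add: star_ball_def nb)
  have "conv_in_prob M (\<lambda>n \<omega>. vertex_avg (G n \<omega>) (\<lambda>v. \<Phi> (nbhd 2 (G n \<omega>) v)))
      (integral\<^sup>L N (\<lambda>\<omega>. \<Phi> (star_ball 2 (Gs \<omega>))))"
    by (intro conv_in_prob_local_functional[OF inv, where B = "real K ^ 3"])
      (auto simp: \<Phi>_def abs_of_nonneg trunc_hom_nonneg trunc_hom_le)
  then show "conv_in_prob M (\<lambda>n \<omega>. vertex_avg (G n \<omega>) (trunc_hom K (G n \<omega>)))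
    (integral\<^sup>L N (\<lambda>\<omega>. trunc_hom K (graph_of (rep_gstar (Gs \<omega>))) (root (rep_gstar (Gs \<omega>)))))"
    unfolding eq
    by (rule conv_in_prob_cong) (auto intro!: vertex_avg_cong nb dest!: random_graph_in finite_graphsD(1))
  show "(\<lambda>\<omega>. trunc_hom K (graph_of (rep_gstar (Gs \<omega>))) (root (rep_gstar (Gs \<omega>)))) \<in> borel_measurable N"
    using isomorphism_invariant_measurable[OF random_limit, of \<Phi> 2] inv unfolding eq by blast
qed

lemma measurable_root_degree: "(\<lambda>\<omega>. real (root_degree (Gs \<omega>))) \<in> borel_measurable N"
proof -
  define \<Phi> where "\<Phi> R = real (vertex_degree (graph_of R) (root R))" for R :: "nat rgraph"
  have inv: "\<Phi> R = \<Phi> S" if "R \<in> finite_rgraphs" "S \<in> finite_rgraphs" "R \<cong>\<^sub>* S" for R S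
    using vertex_degree_root_iso[OF that] by (simp add: \<Phi>_def)
  have "\<Phi> (nbhd 2 g v) = vertex_degree g v" if "simple_graph g" "v \<in> verts g" for g v
    using neighbours_nbhd[OF that, of v 0 2] by (simp add: \<Phi>_def flip: card_neighbours)
  then have "(\<lambda>\<omega>. \<Phi> (star_ball 2 (Gs \<omega>))) = (\<lambda>\<omega>. real (root_degree (Gs \<omega>)))"
    using rep_gstar by (simp add: star_ball_def root_degree.rep_eq)
  then show ?thesis
    using isomorphism_invariant_measurable[OF random_limit, of \<Phi> 2] inv by auto
qed

end

theorem corollary4p2:
  fixes M :: "nat \<Rightarrow> 'w measure" and G :: "nat \<Rightarrow> 'w \<Rightarrow> nat graph"
    and n1 :: "nat \<Rightarrow> nat" and v :: "nat \<Rightarrow> 'w \<Rightarrow> nat"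
    and N :: "'s measure" and Gs :: "'s \<Rightarrow> gstar"
    and d :: "nat \<Rightarrow> 'w \<Rightarrow> real" and ds :: "'s \<Rightarrow> real" and hs :: "'s \<Rightarrow> real"
  defines "d \<equiv> \<lambda>n \<omega>. real (vertex_degree (G n \<omega>) (v n \<omega>))"
    and "ds \<equiv> \<lambda>\<omega>. real (root_degree (Gs \<omega>))"
    and "hs \<equiv> \<lambda>\<omega>. real (root_hom_P4' (Gs \<omega>))"
  assumes prob_M: "\<And>n. prob_space (M n)"
    and random_graph: "\<And>n. G n \<in> measurable (M n) (count_space (finite_graphs (n1 n)))"
    and n1_ge_3: "\<And>n. n1 n \<ge> 3"
    and n1_lim: "filterlim n1 at_top sequentially"
    and uniform: "\<And>n. uniform_vertex (M n) (G n) (v n)"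
    and prob_N: "prob_space N"
    and random_limit: "Gs \<in> borel_measurable N"
    and local_limit: "local_conv_in_prob M G N Gs"
    and third_moment_finite: "integrable N (\<lambda>\<omega>. ds \<omega> ^ 3)"
    and third_moment_lim:
      "(\<lambda>n. prob_space.expectation (M n) (\<lambda>\<omega>. d n \<omega> ^ 3)) \<longlonglongrightarrow> prob_space.expectation N (\<lambda>\<omega>. ds \<omega> ^ 3)"
    and variance_pos: "prob_space.variance N ds > 0"
    and rho_denominator_nonzero:
      "prob_space.expectation N ds * prob_space.expectation N (\<lambda>\<omega>. ds \<omega> ^ 3)
         - (prob_space.expectation N (\<lambda>\<omega>. (ds \<omega>)\<^sup>2))\<^sup>2 \<noteq> 0"
  shows "integrable N hs \<and>
    conv_in_prob M (\<lambda>n \<omega>. assortativity (G n \<omega>))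
      ((prob_space.expectation N ds * prob_space.expectation N hs
          - (prob_space.expectation N (\<lambda>\<omega>. (ds \<omega>)\<^sup>2))\<^sup>2)
       / (prob_space.expectation N ds * prob_space.expectation N (\<lambda>\<omega>. ds \<omega> ^ 3)
          - (prob_space.expectation N (\<lambda>\<omega>. (ds \<omega>)\<^sup>2))\<^sup>2))"
proof -
  interpret random_graphs_local_limit M G n1 N Gs
  proof (rule random_graphs_local_limit.intro)
    show "n1 n > 0" for n using n1_ge_3[of n] by simp
  qed (fact prob_M random_graph prob_N random_limit local_limit)+
  interpret N: prob_space N by (rule prob_N)
  define S where "S k n \<omega> = vertex_avg (G n \<omega>) (\<lambda>v. real (vertex_degree (G n \<omega>) v) ^ k)" for k n \<omega>
  define D where "D K k n \<omega> = vertex_avg (G n \<omega>) (trunc_degree_power K k (G n \<omega>))" for K k n \<omega>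
  define Sh where "Sh n \<omega> = vertex_avg (G n \<omega>) (\<lambda>v. real (hom' P4' (G n \<omega>) v))" for n \<omega>
  define T where "T K n \<omega> = vertex_avg (G n \<omega>) (trunc_hom K (G n \<omega>))" for K n \<omega>
  define c where "c k = integral\<^sup>L N (\<lambda>\<omega>. ds \<omega> ^ k)" for k
  define cD where "cD K k = integral\<^sup>L N (\<lambda>\<omega>. if root_degree (Gs \<omega>) \<le> K then ds \<omega> ^ k else 0)" for K k
  define ts where "ts K \<omega> = trunc_hom K (graph_of (rep_gstar (Gs \<omega>))) (root (rep_gstar (Gs \<omega>)))" for K \<omega>
  note g = finite_graphsD[OF random_graph_in]
  have meas: "S k n \<in> borel_measurable (M n)" "D K k n \<in> borel_measurable (M n)"
    "Sh n \<in> borel_measurable (M n)" "T K n \<in> borel_measurable (M n)" for k K n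
    unfolding S_def D_def Sh_def T_def by (rule graph_functional_measurable)+
  have D_conv: "conv_in_prob M (D K k) (cD K k)" for K k
    unfolding D_def[abs_def] cD_def ds_def by (rule conv_in_prob_trunc_degree_power)
  have T_conv: "conv_in_prob M (T K) (integral\<^sup>L N (ts K))" for K
    unfolding T_def[abs_def] ts_def[abs_def] by (rule conv_in_prob_trunc_hom)
  have cD_lim: "(\<lambda>K. cD K k) \<longlonglongrightarrow> c k" if "0 < k" "k \<le> 3" for k
    unfolding cD_def c_def ds_def
    by (rule truncated_moment_tendsto[OF measurable_root_degree third_moment_finite[unfolded ds_def] that])

  \<comment> \<open>The number of vertices is not random and bounds all degrees, so
    \<open>S 3 n\<close> is a bounded variable for each \<open>n\<close>.\<close>
  have S3_int: "integrable (M n) (S 3 n)" for n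
  proof -
    interpret prob_space "M n" by (rule prob_M)
    have "S 3 n \<omega> \<le> real (n1 n) ^ 3" if \<omega>: "\<omega> \<in> space (M n)" for \<omega>
    proof -
      have "card (verts (G n \<omega>)) = n1 n" using random_graph_in[OF \<omega>] by (simp add: finite_graphs_def)
      then have "S 3 n \<omega> \<le> vertex_avg (G n \<omega>) (\<lambda>v. real (n1 n) ^ 3)"
        unfolding S_def using vertex_degree_le_card[OF g(1,2)[OF \<omega>]]
        by (intro vertex_avg_mono power_mono) auto
      also have "\<dots> \<le> real (n1 n) ^ 3" by (simp add: vertex_avg_def)
      finally show ?thesis .
    qed
    moreover have "S 3 n \<omega> \<ge> 0" for \<omega> by (simp add: S_def vertex_avg_def sum_nonneg)
    ultimately show ?thesis
      using meas(1) by (intro integrable_const_bound[where B = "real (n1 n) ^ 3"]) auto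
  qed
  have S3_exp: "integral\<^sup>L (M n) (S 3 n) = integral\<^sup>L (M n) (\<lambda>\<omega>. d n \<omega> ^ 3)" for n
    using expectation_uniform_vertex[OF prob_M random_graph m_pos uniform, of "\<lambda>g v. real (vertex_degree g v) ^ 3" n]
    by (simp add: S_def[abs_def] d_def)
  have DS: "D K k n \<omega> \<le> S k n \<omega>" for K k n \<omega>
    unfolding D_def S_def by (intro vertex_avg_mono) (simp add: trunc_degree_power_def)
  \<comment> \<open>The lower bounds are the truncated averages \<open>D K 3\<close>; their limits
    \<open>cD K 3\<close> tend to \<open>c 3\<close>, which is also the limit of the expectations of
    \<open>S 3\<close>.\<close>
  have S3_conv: "conv_in_prob M (S 3) (c 3)"
  proof (rule conv_in_prob_if_expectation[OF prob_M S3_int])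
    show "(\<lambda>n. integral\<^sup>L (M n) (S 3 n)) \<longlonglongrightarrow> c 3"
      unfolding S3_exp c_def by (rule third_moment_lim)
    show "S 3 n \<omega> \<ge> 0" for n \<omega> by (simp add: S_def vertex_avg_def sum_nonneg)
    show "(\<lambda>K. cD K 3) \<longlonglongrightarrow> c 3" by (rule cD_lim) auto
  qed (use D_conv meas DS in auto)

  \<comment> \<open>This difference is the common error bound, up to a factor 2, for all averages
    below. It becomes available as a convergent quantity only now that \<open>S 3\<close>
    converges.\<close>
  have Z_conv: "conv_in_prob M (\<lambda>n \<omega>. S 3 n \<omega> - D K 3 n \<omega>) (c 3 - cD K 3)" for K
    by (intro conv_in_prob_diff prob_M S3_conv D_conv meas)
  have Z_lim: "(\<lambda>K. c 3 - cD K 3) \<longlonglongrightarrow> 0"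
    using tendsto_diff[OF tendsto_const cD_lim[of 3], of "c 3"] by simp
  have S_conv: "conv_in_prob M (S k) (c k)" if k: "0 < k" "k \<le> 3" for k
  proof (rule conv_in_prob_approx[OF prob_M D_conv meas(2) Z_conv])
    show "(\<lambda>\<omega>. S 3 n \<omega> - D K 3 n \<omega>) \<in> borel_measurable (M n)" for K n
      using meas by (intro borel_measurable_diff)
    show "\<bar>S k n \<omega> - D K k n \<omega>\<bar> \<le> S 3 n \<omega> - D K 3 n \<omega>" for K n \<omega>
      unfolding S_def D_def by (rule abs_vertex_avg_degree_power_diff_trunc_le[OF k])
  qed (rule cD_lim[OF k] Z_lim)+

  have ts_meas: "ts K \<in> borel_measurable N" for K
    unfolding ts_def[abs_def] by (rule measurable_trunc_hom)
  have ts_int: "integrable N (ts K)" for K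
    using ts_meas by (intro N.integrable_const_bound[where B = "real K ^ 3"])
      (auto simp: ts_def abs_of_nonneg trunc_hom_nonneg trunc_hom_le)
  have ts_mono: "mono (\<lambda>K. ts K \<omega>)" for \<omega> unfolding ts_def by (rule trunc_hom_mono)
  have ts_lim: "(\<lambda>K. ts K \<omega>) \<longlonglongrightarrow> hs \<omega>" for \<omega>
    unfolding ts_def hs_def root_hom_P4'.rep_eq using rep_gstar by (intro trunc_hom_tendsto)
  \<comment> \<open>The bound by cubes holds for each finite graph as a whole and passes to the
    limit. Being uniform in \<open>K\<close>, it keeps the increasing expectations of
    \<open>ts K\<close> bounded, so that monotone convergence yields integrability of
    \<open>hs\<close>.\<close>
  have "integral\<^sup>L N (ts K) \<le> c 3" for K
  proof (rule conv_in_prob_le[OF prob_M T_conv meas(4) S3_conv meas(1)])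
    fix n \<omega> assume "\<omega> \<in> space (M n)"
    then show "T K n \<omega> \<le> S 3 n \<omega>"
      unfolding T_def S_def vertex_avg_def
      using sum_trunc_hom_le[OF g(1,2)] by (intro divide_right_mono) auto
  qed
  moreover have "incseq (\<lambda>K. integral\<^sup>L N (ts K))"
    using ts_int ts_mono by (intro monoI integral_mono) (auto dest: monoD)
  ultimately obtain L where L: "(\<lambda>K. integral\<^sup>L N (ts K)) \<longlonglongrightarrow> L"
    by (metis incseq_convergent)
  have hs_meas: "hs \<in> borel_measurable N"
    by (rule borel_measurable_LIMSEQ_real[OF ts_lim ts_meas])
  have hs_int: "integrable N hs"
    by (rule integrable_monotone_convergence[OF ts_int _ _ L hs_meas]) (use ts_mono ts_lim in auto)
  have hs_exp: "integral\<^sup>L N hs = L"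
    by (rule integral_monotone_convergence[OF ts_int _ _ L hs_meas]) (use ts_mono ts_lim in auto)

  have Sh_conv: "conv_in_prob M Sh (integral\<^sup>L N hs)"
  proof (rule conv_in_prob_approx[OF prob_M T_conv meas(4)])
    show "conv_in_prob M (\<lambda>n \<omega>. 2 * (S 3 n \<omega> - D K 3 n \<omega>)) (2 * (c 3 - cD K 3))" for K
      using meas by (intro conv_in_prob_mult prob_M conv_in_prob_const Z_conv borel_measurable_diff) auto
    show "(\<lambda>\<omega>. 2 * (S 3 n \<omega> - D K 3 n \<omega>)) \<in> borel_measurable (M n)" for K n
      using meas by (intro borel_measurable_times borel_measurable_diff) auto
    show "\<bar>Sh n \<omega> - T K n \<omega>\<bar> \<le> 2 * (S 3 n \<omega> - D K 3 n \<omega>)" if "\<omega> \<in> space (M n)" for K n \<omega>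
      unfolding Sh_def T_def S_def D_def by (rule abs_vertex_avg_hom_diff_trunc_le[OF g(1,2)[OF that]])
    show "(\<lambda>K. integral\<^sup>L N (ts K)) \<longlonglongrightarrow> integral\<^sup>L N hs" using L hs_exp by simp
    show "(\<lambda>K. 2 * (c 3 - cD K 3)) \<longlonglongrightarrow> 0" using tendsto_mult_left[OF Z_lim, of 2] by simp
  qed

  \<comment> \<open>Squares are written as products to match the rules for limits. The quotient rule
    applies because the limit of the denominator is assumed to be nonzero.\<close>
  have "conv_in_prob M (\<lambda>n \<omega>. (S 1 n \<omega> * Sh n \<omega> - S 2 n \<omega> * S 2 n \<omega>) / (S 1 n \<omega> * S 3 n \<omega> - S 2 n \<omega> * S 2 n \<omega>))
      ((c 1 * integral\<^sup>L N hs - c 2 * c 2) / (c 1 * c 3 - c 2 * c 2))"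
    using rho_denominator_nonzero
    by (intro conv_in_prob_divide conv_in_prob_diff conv_in_prob_mult prob_M S_conv Sh_conv
        borel_measurable_diff borel_measurable_times meas) (auto simp: c_def power2_eq_square)
  then have "conv_in_prob M (\<lambda>n \<omega>. assortativity (G n \<omega>))
      ((c 1 * integral\<^sup>L N hs - c 2 * c 2) / (c 1 * c 3 - c 2 * c 2))"
  proof (rule conv_in_prob_cong)
    fix n \<omega> assume "\<omega> \<in> space (M n)"
    from assortativity_eq[OF g(1,2)[OF this]]
    show "(S 1 n \<omega> * Sh n \<omega> - S 2 n \<omega> * S 2 n \<omega>) / (S 1 n \<omega> * S 3 n \<omega> - S 2 n \<omega> * S 2 n \<omega>) = assortativity (G n \<omega>)"
      by (simp add: S_def Sh_def power2_eq_square)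
  qed
  then show ?thesis
    using hs_int by (simp add: c_def power2_eq_square)
qed

end
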